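(* Let $B$ be a graphic matroid. Then the element splitting matroid $B_X'$ is a binary gammoid for every $X \subseteq E(B)$ with $|X| \geq 2$ if and only if $B$ has no minor isomorphic to $M(G_7)$, where $G_7$ is the graph with vertices $t,a,b$ and five edges: two parallel edges between $t$ and $a$, two parallel edges between $t$ and $b$, and one edge between $a$ and $b$.
   Context: Element splitting: let $B$ be a binary matroid represented over $GF(2)$ by a matrix $A$, and let $X \subseteq E(B)$. Let $A_X'$ be the matrix obtained from $A$ by appending a new last row with entry $1$ in the columns of the elements of $X$ and $0$ elsewhere, and then appending a new column labelled $q$ with entry $1$ in the new row and $0$ elsewhere. The element splitting matroid is $B_X' = M(A_X')$. A binary gammoid is a matroid that is both binary and a gammoid (equivalently, one with no minor isomorphic to $U_{2,4}$ or $M(K_4)$). $M(G)$ is the cycle matroid of $G$. *)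

theory Defs
  imports Main "HOL-Library.Z2" "Graph_Theory.Arc_Walk"
begin

section \<open>Finite matroids\<close>

record 'a indep_sys =
  ground :: "'a set"
  indeps :: "'a set set"

definition matroid :: "'a indep_sys \<Rightarrow> bool" where
  "matroid M \<longleftrightarrow>
     finite (ground M) \<and>
     (\<forall>I\<in>indeps M. I \<subseteq> ground M) \<and>
     {} \<in> indeps M \<and>
     (\<forall>I\<in>indeps M. \<forall>J. J \<subseteq> I \<longrightarrow> J \<in> indeps M) \<and>
     (\<forall>I\<in>indeps M. \<forall>J\<in>indeps M. card I < card J \<longrightarrow>
        (\<exists>x\<in>J - I. insert x I \<in> indeps M))"

definition matroid_iso :: "'a indep_sys \<Rightarrow> 'b indep_sys \<Rightarrow> bool" where
  "matroid_iso M N \<longleftrightarrow>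
     (\<exists>f. bij_betw f (ground M) (ground N) \<and>
          (\<forall>I. I \<subseteq> ground M \<longrightarrow> (I \<in> indeps M \<longleftrightarrow> f ` I \<in> indeps N)))"

definition basis_of :: "'a indep_sys \<Rightarrow> 'a set \<Rightarrow> 'a set \<Rightarrow> bool" where
  "basis_of M C J \<longleftrightarrow>
     J \<subseteq> C \<and> J \<in> indeps M \<and> (\<forall>K. J \<subseteq> K \<and> K \<subseteq> C \<and> K \<in> indeps M \<longrightarrow> K = J)"

definition matroid_delete :: "'a indep_sys \<Rightarrow> 'a set \<Rightarrow> 'a indep_sys" where
  "matroid_delete M D =
     \<lparr>ground = ground M - D, indeps = {I \<in> indeps M. I \<subseteq> ground M - D}\<rparr>"

definition matroid_contract :: "'a indep_sys \<Rightarrow> 'a set \<Rightarrow> 'a indep_sys" where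
  "matroid_contract M C =
     \<lparr>ground = ground M - C,
      indeps = {I. I \<subseteq> ground M - C \<and> (\<exists>J. basis_of M C J \<and> I \<union> J \<in> indeps M)}\<rparr>"

definition is_minor :: "'a indep_sys \<Rightarrow> 'a indep_sys \<Rightarrow> bool" where
  "is_minor N M \<longleftrightarrow>
     (\<exists>C D. C \<subseteq> ground M \<and> D \<subseteq> ground M \<and> C \<inter> D = {} \<and>
            N = matroid_delete (matroid_contract M C) D)"

definition has_minor_iso :: "'a indep_sys \<Rightarrow> 'b indep_sys \<Rightarrow> bool" where
  "has_minor_iso M K \<longleftrightarrow> (\<exists>N. is_minor N M \<and> matroid_iso N K)"


section \<open>Binary matroids and element splitting\<close>

text \<open>
  A matrix over GF(2) with \<open>m\<close> rows, and columns labelled by elements of type \<open>'a\<close>, is a function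
  \<open>A :: nat \<Rightarrow> 'a \<Rightarrow> bit\<close> of which only the rows \<open>i < m\<close> matter.  Linear independence is that of the
  family of columns, so two equal columns with different labels are dependent.
\<close>

definition indep_columns :: "nat \<Rightarrow> (nat \<Rightarrow> 'a \<Rightarrow> bit) \<Rightarrow> 'a set \<Rightarrow> bool" where
  "indep_columns m A I \<longleftrightarrow>
     (\<forall>c :: 'a \<Rightarrow> bit. (\<forall>i<m. (\<Sum>e\<in>I. c e * A i e) = 0) \<longrightarrow> (\<forall>e\<in>I. c e = 0))"

definition vector_matroid :: "nat \<Rightarrow> (nat \<Rightarrow> 'a \<Rightarrow> bit) \<Rightarrow> 'a set \<Rightarrow> 'a indep_sys" where
  "vector_matroid m A E = \<lparr>ground = E, indeps = {I. I \<subseteq> E \<and> indep_columns m A I}\<rparr>"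

definition represents :: "nat \<Rightarrow> (nat \<Rightarrow> 'a \<Rightarrow> bit) \<Rightarrow> 'a indep_sys \<Rightarrow> bool" where
  "represents m A M \<longleftrightarrow> M = vector_matroid m A (ground M)"

definition binary_matroid :: "'a indep_sys \<Rightarrow> bool" where
  "binary_matroid M \<longleftrightarrow> matroid M \<and> (\<exists>m A. represents m A M)"

text \<open>The new row has index \<open>m\<close>; the new column has label \<open>q\<close>.\<close>

definition splitting_matrix ::
    "nat \<Rightarrow> (nat \<Rightarrow> 'a \<Rightarrow> bit) \<Rightarrow> 'a set \<Rightarrow> 'a \<Rightarrow> nat \<Rightarrow> 'a \<Rightarrow> bit" where
  "splitting_matrix m A X q i e =
     (if e = q then (if i = m then 1 else 0)
      else if i = m then (if e \<in> X then 1 else 0)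
      else A i e)"

definition element_splitting ::
    "nat \<Rightarrow> (nat \<Rightarrow> 'a \<Rightarrow> bit) \<Rightarrow> 'a indep_sys \<Rightarrow> 'a set \<Rightarrow> 'a \<Rightarrow> 'a indep_sys" where
  "element_splitting m A B X q =
     vector_matroid (Suc m) (splitting_matrix m A X q) (insert q (ground B))"


section \<open>Gammoids\<close>

definition linked_into :: "('v, 'e) pre_digraph \<Rightarrow> 'v set \<Rightarrow> 'v set \<Rightarrow> bool" where
  "linked_into G T X \<longleftrightarrow>
     (\<exists>p t. (\<forall>x\<in>X. t x \<in> T \<and> pre_digraph.apath G x (p x) (t x)) \<and>
            (\<forall>x\<in>X. \<forall>y\<in>X. x \<noteq> y \<longrightarrow>
               set (pre_digraph.awalk_verts G x (p x)) \<inter>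
               set (pre_digraph.awalk_verts G y (p y)) = {}))"

definition linkage_matroid :: "('v, 'e) pre_digraph \<Rightarrow> 'v set \<Rightarrow> 'v set \<Rightarrow> 'v indep_sys" where
  "linkage_matroid G T S = \<lparr>ground = S, indeps = {X. X \<subseteq> S \<and> linked_into G T X}\<rparr>"

text \<open>As everything is finite, taking vertices and arcs in \<open>nat\<close> is no restriction.\<close>

definition gammoid :: "'a indep_sys \<Rightarrow> bool" where
  "gammoid M \<longleftrightarrow>
     matroid M \<and>
     (\<exists>(G :: (nat, nat) pre_digraph) T S.
        fin_digraph G \<and> T \<subseteq> verts G \<and> S \<subseteq> verts G \<and> matroid_iso M (linkage_matroid G T S))"

definition binary_gammoid :: "'a indep_sys \<Rightarrow> bool" where
  "binary_gammoid M \<longleftrightarrow> binary_matroid M \<and> gammoid M"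


section \<open>Graphic matroids\<close>

record ('v, 'e) multigraph =
  mverts :: "'v set"
  medges :: "'e set"
  ends :: "'e \<Rightarrow> 'v set"

text \<open>Parallel edges are allowed, and so are loops, as edges with a single end.\<close>

definition fin_multigraph :: "('v, 'e) multigraph \<Rightarrow> bool" where
  "fin_multigraph G \<longleftrightarrow>
     finite (mverts G) \<and> finite (medges G) \<and>
     (\<forall>e\<in>medges G. ends G e \<subseteq> mverts G \<and> card (ends G e) \<in> {1, 2})"

text \<open>
  The edge set of a cycle of length \<open>k \<ge> 1\<close>: \<open>es ! i\<close> joins \<open>vs ! i\<close> to \<open>vs ! (i + 1)\<close>, indices modulo
  \<open>k\<close>.  A loop is a cycle of length 1, a pair of parallel edges a cycle of length 2.
\<close>

definition is_cycle :: "('v, 'e) multigraph \<Rightarrow> 'e set \<Rightarrow> bool" where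
  "is_cycle G C \<longleftrightarrow>
     (\<exists>vs es. es \<noteq> [] \<and> length vs = length es \<and> distinct vs \<and> distinct es \<and>
        set vs \<subseteq> mverts G \<and> set es \<subseteq> medges G \<and> C = set es \<and>
        (\<forall>i<length es. ends G (es ! i) = {vs ! i, vs ! (Suc i mod length es)}))"

definition cycle_matroid :: "('v, 'e) multigraph \<Rightarrow> 'e indep_sys" where
  "cycle_matroid G =
     \<lparr>ground = medges G, indeps = {I. I \<subseteq> medges G \<and> \<not> (\<exists>C. is_cycle G C \<and> C \<subseteq> I)}\<rparr>"

definition graphic :: "'a indep_sys \<Rightarrow> bool" where
  "graphic M \<longleftrightarrow>
     matroid M \<and>
     (\<exists>G :: (nat, nat) multigraph. fin_multigraph G \<and> matroid_iso M (cycle_matroid G))"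

text \<open>Here \<open>0, 1, 2\<close> stand for \<open>t, a, b\<close>.\<close>

definition G7 :: "(nat, nat) multigraph" where
  "G7 = \<lparr>mverts = {0, 1, 2}, medges = {0, 1, 2, 3, 4},
         ends = (\<lambda>e. [{0, 1}, {0, 1}, {0, 2}, {0, 2}, {1, 2}] ! e)\<rparr>"

end

theory Submission
  imports Defs
begin

text \<open>
  A binary matroid is determined by its cycle space, and splitting on \<open>X\<close> adds \<open>q\<close> to exactly those
  cycles that meet \<open>X\<close> in an odd number of elements.

  If \<open>B\<close> has a minor \<open>M(G7)\<close>, splitting on one edge of each parallel pair turns it into \<open>M(K4)\<close>.  Gammoids
  are base-orderable, a property that survives in minors, and \<open>M(K4)\<close> is not base-orderable.

  If \<open>B\<close> has no such minor and is nonempty, it has a loop, a coloop, a series pair or three parallel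
  elements, two of which agree on membership in \<open>X\<close>.  Hence the split matroid has a loop, a coloop, a
  series pair or a parallel pair whose removal leaves the splitting of a smaller matroid without
  \<open>M(G7)\<close>, and gammoids are closed under the four inverse extensions.
\<close>

section \<open>Linkings as matchings\<close>

text \<open>Element splitting is a coextension: contracting \<open>q\<close> in the splitting gives
  \<open>B\<close> back. \<open>G7\<close> is a triangle with two sides doubled, which is what
  remains of K4 when one edge is contracted, and this is why it is the obstruction. Two difficulties
  shape the proof. Systems of disjoint paths are awkward to modify, so they are traded for
  bijections between complements of vertex sets; attaching a vertex, and exchanging two linkings,
  then become local changes of a bijection. And to rule out \<open>M(K4)\<close> without proving
  that gammoids are closed under contraction, no minor of the splitting is formed there: the
  exchange map fixes the common elements of two independent sets, so adding the contracted set to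
  both of them has the same effect as contracting it.\<close>

lemma orbit_unique:
  assumes "inj_on s D" "x \<notin> s ` D" "y \<notin> s ` D"
    and "\<forall>k<i. (s ^^ k) x \<in> D" "\<forall>k<j. (s ^^ k) y \<in> D" "(s ^^ i) x = (s ^^ j) y"
  shows "x = y \<and> i = j"
  using assms(4-6)
proof (induction i arbitrary: j)
  case 0
  then show ?case using assms(2) by (cases j) auto
next
  case (Suc i)
  show ?case
  proof (cases j)
    case 0
    then show ?thesis using Suc.prems assms(3) by auto
  next
    case (Suc j')
    \<comment> \<open>Injectivity cancels the last step on both sides; the descent stops at a
      starting point, which is no value of \<open>s\<close>.\<close>
    then have "(s ^^ i) x = (s ^^ j') y"
      using Suc.prems assms(1) by (auto simp: inj_on_def)
    then show ?thesis using Suc.IH[of j'] Suc.prems Suc by auto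
  qed
qed

text \<open>Otherwise the whole orbit stays in \<open>D\<close>, and \<open>orbit_unique\<close>
  applied to \<open>x\<close> with itself makes its points pairwise distinct, too many for a finite
  set.\<close>

lemma orbit_exits:
  assumes "finite D" "inj_on s D" "x \<notin> s ` D"
  shows "\<exists>n. (s ^^ n) x \<notin> D \<and> (\<forall>k<n. (s ^^ k) x \<in> D)"
proof -
  have "\<exists>n. (s ^^ n) x \<notin> D"
  proof (rule ccontr)
    assume "\<not> ?thesis"
    then have D: "(s ^^ n) x \<in> D" for n by blast
    have "inj (\<lambda>n. (s ^^ n) x)"
      using orbit_unique[OF assms(2,3,3)] D by (auto simp: inj_on_def)
    moreover have "range (\<lambda>n. (s ^^ n) x) \<subseteq> D" using D by auto
    ultimately show False
      using assms(1) infinite_UNIV_nat inj_on_finite by blast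
  qed
  then obtain n where "(s ^^ n) x \<notin> D" "\<forall>k<n. \<not> (s ^^ k) x \<notin> D"
    using exists_least_iff[of "\<lambda>n. (s ^^ n) x \<notin> D"] by blast
  then show ?thesis by blast
qed

text \<open>\<open>h\<close> sends a vertex to its predecessor on its path, so the starting points
  \<open>X\<close> drop out of the domain and the end points \<open>T'\<close> out of the range.
  \<open>T'\<close> collects the ends in use, since \<open>X\<close> may be smaller than
  \<open>T\<close>.\<close>

definition linkable :: "'v set \<Rightarrow> ('v \<times> 'v) set \<Rightarrow> 'v set \<Rightarrow> 'v set \<Rightarrow> bool" where
  "linkable V R T X \<longleftrightarrow>
     (\<exists>h T'. T' \<subseteq> T \<and> bij_betw h (V - X) (V - T') \<and> (\<forall>w\<in>V - X. h w = w \<or> (h w, w) \<in> R))"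

lemma (in wf_digraph) awalk_verts_arcs_ends:
  assumes "awalk u p v" "Suc i < length (awalk_verts u p)"
  shows "(awalk_verts u p ! i, awalk_verts u p ! Suc i) \<in> arcs_ends G"
  using assms
proof (induction p arbitrary: u i)
  case (Cons e p)
  have e: "e \<in> arcs G" "awalk (head G e) p v" using Cons.prems by (auto simp: awalk_Cons_iff)
  have hd: "awalk_verts (head G e) p ! 0 = head G e"
    using e(2) by (metis awalkE awalk_verts_non_Nil hd_conv_nth)
  show ?case
  proof (cases i)
    case 0
    then show ?thesis using e hd by (auto simp: arcs_ends_conv)
  next
    case (Suc j)
    then show ?thesis using Cons e by auto
  qed
qed auto

lemma (in wf_digraph) awalk_of_verts:
  assumes "u \<in> verts G" "\<And>i. i < n \<Longrightarrow> (f i, f (Suc i)) \<in> arcs_ends G" "u = f 0"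
  shows "\<exists>p. awalk u p (f n) \<and> awalk_verts u p = map f [0..<Suc n]"
  using assms
proof (induction n arbitrary: u f)
  case 0
  then show ?case by (intro exI[of _ "[]"]) (auto simp: awalk_Nil_iff)
next
  case (Suc n)
  obtain e where e: "e \<in> arcs G" "tail G e = f 0" "head G e = f 1"
    using Suc.prems(2)[of 0] by (auto simp: arcs_ends_conv)
  have "\<exists>p. awalk (f 1) p ((\<lambda>i. f (Suc i)) n) \<and> awalk_verts (f 1) p = map (\<lambda>i. f (Suc i)) [0..<Suc n]"
    by (rule Suc.IH) (use Suc.prems(2) head_in_verts[OF e(1)] e(3) in simp_all)
  then obtain p where p: "awalk (f 1) p (f (Suc n))" "awalk_verts (f 1) p = map (\<lambda>i. f (Suc i)) [0..<Suc n]"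
    by auto
  have "map f [0..<Suc (Suc n)] = f 0 # map (\<lambda>i. f (Suc i)) [0..<Suc n]"
    by (simp add: upt_conv_Cons map_Suc_upt[symmetric] del: upt_Suc map_Suc_upt)
  then show ?case using p e Suc.prems
    by (intro exI[of _ "e # p"]) (auto simp: awalk_Cons_iff simp del: upt_Suc)
qed

text \<open>The vertices off the paths are matched to themselves, those on a path to their predecessors
  (Ingleton and Piff).\<close>

lemma (in wf_digraph) linked_into_imp_linkable:
  assumes "linked_into G T X"
  shows "linkable (verts G) (arcs_ends G) T X"
proof -
  obtain p t where
    pt: "\<And>x. x \<in> X \<Longrightarrow> t x \<in> T \<and> apath x (p x) (t x)" and
    disj: "\<And>x y. x \<in> X \<Longrightarrow> y \<in> X \<Longrightarrow> x \<noteq> y \<Longrightarrow>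
        set (awalk_verts x (p x)) \<inter> set (awalk_verts y (p y)) = {}"
    using assms unfolding linked_into_def by blast
  define ws where "ws x = awalk_verts x (p x)" for x
  have aw: "awalk x (p x) (t x)" and dist: "distinct (ws x)" if "x \<in> X" for x
    using pt[OF that] by (auto simp: apath_def ws_def)
  have len: "length (ws x) = Suc (length (p x))" for x
    by (simp add: ws_def length_awalk_verts)
  have first: "ws x ! 0 = x" and last: "ws x ! length (p x) = t x" if "x \<in> X" for x
    using aw[OF that] len[of x] unfolding ws_def
    by (metis awalkE awalk_verts_non_Nil hd_conv_nth,
        metis awalkE awalk_verts_non_Nil last_conv_nth diff_Suc_1)
  have inV: "ws x ! i \<in> verts G" if "x \<in> X" "i \<le> length (p x)" for x i
    using aw[OF that(1)] nth_mem[of i "ws x"] len[of x] that unfolding ws_def awalk_conv by auto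
  have uniq: "x = y \<and> i = j"
    if "x \<in> X" "y \<in> X" "i \<le> length (p x)" "j \<le> length (p y)" "ws x ! i = ws y ! j" for x y i j
  proof -
    have "ws x ! i \<in> set (ws x)" "ws y ! j \<in> set (ws y)"
      using that(3,4) len by (simp_all add: less_Suc_eq_le)
    then have "x = y" using disj that unfolding ws_def by fastforce
    then show ?thesis using dist[of x] that len by (auto simp: nth_eq_iff_index_eq less_Suc_eq_le)
  qed
  \<comment> \<open>\<open>h\<close> steps back along the paths and \<open>k\<close> forward, and
    both fix the vertices off the paths. By \<open>uniq\<close> each choice has only one
    candidate.\<close>
  define h where "h w = (if \<exists>x i. x \<in> X \<and> i < length (p x) \<and> w = ws x ! Suc i
      then (SOME v. \<exists>x i. x \<in> X \<and> i < length (p x) \<and> w = ws x ! Suc i \<and> v = ws x ! i) else w)" for w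
  define k where "k v = (if \<exists>x i. x \<in> X \<and> i < length (p x) \<and> v = ws x ! i
      then (SOME w. \<exists>x i. x \<in> X \<and> i < length (p x) \<and> v = ws x ! i \<and> w = ws x ! Suc i) else v)" for v
  have h1: "h (ws x ! Suc i) = ws x ! i" if "x \<in> X" "i < length (p x)" for x i
  proof -
    have "(SOME v. \<exists>y j. y \<in> X \<and> j < length (p y) \<and> ws x ! Suc i = ws y ! Suc j \<and> v = ws y ! j) = ws x ! i"
    proof (rule some_equality)
      fix v assume "\<exists>y j. y \<in> X \<and> j < length (p y) \<and> ws x ! Suc i = ws y ! Suc j \<and> v = ws y ! j"
      then obtain y j where "y \<in> X" "j < length (p y)" "ws x ! Suc i = ws y ! Suc j" "v = ws y ! j" by blast
      then show "v = ws x ! i" using uniq[of x y "Suc i" "Suc j"] that by simp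
    qed (use that in blast)
    then show ?thesis using that unfolding h_def by (metis (mono_tags))
  qed
  have k1: "k (ws x ! i) = ws x ! Suc i" if "x \<in> X" "i < length (p x)" for x i
  proof -
    have "(SOME v. \<exists>y j. y \<in> X \<and> j < length (p y) \<and> ws x ! i = ws y ! j \<and> v = ws y ! Suc j) = ws x ! Suc i"
    proof (rule some_equality)
      fix v assume "\<exists>y j. y \<in> X \<and> j < length (p y) \<and> ws x ! i = ws y ! j \<and> v = ws y ! Suc j"
      then obtain y j where "y \<in> X" "j < length (p y)" "ws x ! i = ws y ! j" "v = ws y ! Suc j" by blast
      then show "v = ws x ! Suc i" using uniq[of x y i j] that by simp
    qed (use that in blast)
    then show ?thesis using that unfolding k_def by auto
  qed
  have off: "h w = w" "k w = w" if "\<And>x i. x \<in> X \<Longrightarrow> i \<le> length (p x) \<Longrightarrow> w \<noteq> ws x ! i" for w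
  proof -
    have "\<not> (\<exists>x i. x \<in> X \<and> i < length (p x) \<and> w = ws x ! Suc i)"
      using that Suc_leI by blast
    then show "h w = w" unfolding h_def by (rule if_not_P)
    have "\<not> (\<exists>x i. x \<in> X \<and> i < length (p x) \<and> w = ws x ! i)"
      using that less_imp_le by blast
    then show "k w = w" unfolding k_def by (rule if_not_P)
  qed
  have on: thesis
    if "w \<notin> X" "\<And>x i. x \<in> X \<Longrightarrow> i < length (p x) \<Longrightarrow> w = ws x ! Suc i \<Longrightarrow> thesis"
      "(\<And>x i. x \<in> X \<Longrightarrow> i \<le> length (p x) \<Longrightarrow> w \<noteq> ws x ! i) \<Longrightarrow> thesis" for w thesis
  proof (cases "\<exists>x i. x \<in> X \<and> i \<le> length (p x) \<and> w = ws x ! i")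
    case True
    then obtain x i where *: "x \<in> X" "i \<le> length (p x)" "w = ws x ! i" by blast
    then have "i \<noteq> 0" using first[OF *(1)] that(1) by metis
    then obtain j where "i = Suc j" using not0_implies_Suc by blast
    then show thesis using that(2)[OF *(1), of j] *(2,3) by simp
  qed (use that in blast)
  have on': thesis
    if "w \<notin> t ` X" "\<And>x i. x \<in> X \<Longrightarrow> i < length (p x) \<Longrightarrow> w = ws x ! i \<Longrightarrow> thesis"
      "(\<And>x i. x \<in> X \<Longrightarrow> i \<le> length (p x) \<Longrightarrow> w \<noteq> ws x ! i) \<Longrightarrow> thesis" for w thesis
  proof (cases "\<exists>x i. x \<in> X \<and> i \<le> length (p x) \<and> w = ws x ! i")
    case True
    then obtain x i where *: "x \<in> X" "i \<le> length (p x)" "w = ws x ! i" by blast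
    then have "i \<noteq> length (p x)" using last[OF *(1)] that(1) by blast
    then show thesis using that(2)[OF *(1) _ *(3)] *(2) by simp
  qed (use that in blast)
  have notX: "ws x ! Suc i \<notin> X" if "x \<in> X" "i < length (p x)" for x i
  proof
    assume X: "ws x ! Suc i \<in> X"
    show False using uniq[OF that(1) X, of "Suc i" 0] first[OF X] that by simp
  qed
  have notT: "ws x ! i \<notin> t ` X" if "x \<in> X" "i < length (p x)" for x i
  proof
    assume "ws x ! i \<in> t ` X"
    then obtain y where y: "y \<in> X" "ws x ! i = t y" by blast
    show False using uniq[OF that(1) y(1), of i "length (p y)"] last[OF y(1)] y(2) that by auto
  qed
  have "bij_betw h (verts G - X) (verts G - t ` X)"
  proof (rule bij_betw_byWitness[where f' = k])
    have "k (h w) = w \<and> h w \<in> verts G - t ` X" if "w \<in> verts G" "w \<notin> X" for w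
      using that(2)
    proof (rule on)
      fix x i assume "x \<in> X" "i < length (p x)" "w = ws x ! Suc i"
      then show ?thesis using h1 k1 notT inV by auto
    next
      assume *: "\<And>x i. x \<in> X \<Longrightarrow> i \<le> length (p x) \<Longrightarrow> w \<noteq> ws x ! i"
      then have "w \<notin> t ` X" using last by (metis image_iff order_refl)
      then show ?thesis using off[OF *] that by auto
    qed
    then show "\<forall>w\<in>verts G - X. k (h w) = w" "h ` (verts G - X) \<subseteq> verts G - t ` X" by auto
    have "h (k w) = w \<and> k w \<in> verts G - X" if "w \<in> verts G" "w \<notin> t ` X" for w
      using that(2)
    proof (rule on')
      fix x i assume "x \<in> X" "i < length (p x)" "w = ws x ! i"
      then show ?thesis using h1 k1 notX inV by auto
    next
      assume *: "\<And>x i. x \<in> X \<Longrightarrow> i \<le> length (p x) \<Longrightarrow> w \<noteq> ws x ! i"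
      then have "w \<notin> X" using first by (metis le0)
      then show ?thesis using off[OF *] that by auto
    qed
    then show "\<forall>w\<in>verts G - t ` X. h (k w) = w" "k ` (verts G - t ` X) \<subseteq> verts G - X" by auto
  qed
  moreover have "h w = w \<or> (h w, w) \<in> arcs_ends G" if "w \<notin> X" for w
    using that
  proof (rule on)
    fix x i assume *: "x \<in> X" "i < length (p x)" "w = ws x ! Suc i"
    then have "(ws x ! i, ws x ! Suc i) \<in> arcs_ends G"
      using awalk_verts_arcs_ends[OF aw[OF *(1)], of i] len[of x] by (simp add: ws_def)
    then show ?thesis using * h1 by auto
  qed (use off in blast)
  moreover have "t ` X \<subseteq> T" using pt by auto
  ultimately show ?thesis unfolding linkable_def by blast
qed

text \<open>The inverse \<open>s\<close> of the matching is a successor map. No element of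
  \<open>X\<close> is a value of \<open>s\<close>, so by \<open>orbit_unique\<close> the orbits
  started in \<open>X\<close> are disjoint and without repetition, and each runs until it meets
  \<open>T'\<close>.\<close>

lemma (in fin_digraph) linkable_imp_linked_into:
  assumes "linkable (verts G) (arcs_ends G) T X" "T \<subseteq> verts G" "X \<subseteq> verts G"
  shows "linked_into G T X"
proof -
  obtain h T' where T': "T' \<subseteq> T" and h: "bij_betw h (verts G - X) (verts G - T')"
    and R: "\<And>w. w \<in> verts G - X \<Longrightarrow> h w = w \<or> (h w, w) \<in> arcs_ends G"
    using assms(1) unfolding linkable_def by blast
  define D where "D = verts G - T'"
  define s where "s = inv_into (verts G - X) h"
  have s: "bij_betw s D (verts G - X)" using h unfolding s_def D_def by (rule bij_betw_inv_into)
  have hs: "h (s v) = v" if "v \<in> D" for v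
    using h that unfolding s_def D_def by (rule bij_betw_inv_into_right)
  have inj: "inj_on s D" and img: "s ` D = verts G - X" using s by (auto simp: bij_betw_def)
  have fin: "finite D" by (simp add: D_def)
  have xn: "x \<notin> s ` D" if "x \<in> X" for x using img that by auto
  have "\<forall>x\<in>X. \<exists>n. (s ^^ n) x \<notin> D \<and> (\<forall>k<n. (s ^^ k) x \<in> D)"
    using orbit_exits[OF fin inj xn] by blast
  then obtain n where n: "\<And>x. x \<in> X \<Longrightarrow> (s ^^ n x) x \<notin> D"
      "\<And>x k. x \<in> X \<Longrightarrow> k < n x \<Longrightarrow> (s ^^ k) x \<in> D" by metis
  have inV: "(s ^^ k) x \<in> verts G" if "x \<in> X" "k \<le> n x" for x k
  proof (cases k)
    case 0
    then show ?thesis using assms(3) that by auto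
  next
    case (Suc j)
    then have "(s ^^ k) x \<in> s ` D" using n(2)[of x j] that by auto
    then show ?thesis using img by auto
  qed
  have uniq: "x = y \<and> i = j"
    if "x \<in> X" "y \<in> X" "i \<le> n x" "j \<le> n y" "(s ^^ i) x = (s ^^ j) y" for x y i j
    using orbit_unique[OF inj xn xn, of x y i j] n(2) that by auto
  have "\<forall>x\<in>X. \<exists>p. awalk x p ((s ^^ n x) x) \<and> awalk_verts x p = map (\<lambda>i. (s ^^ i) x) [0..<Suc (n x)]"
  proof
    fix x assume x: "x \<in> X"
    show "\<exists>p. awalk x p ((s ^^ n x) x) \<and> awalk_verts x p = map (\<lambda>i. (s ^^ i) x) [0..<Suc (n x)]"
    proof (rule awalk_of_verts)
      show "x \<in> verts G" using x assms(3) by auto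
      fix i assume i: "i < n x"
      have d: "(s ^^ i) x \<in> D" using n(2) x i by auto
      then have "s ((s ^^ i) x) \<in> verts G - X" using img by auto
      \<comment> \<open>A fixed point of the matching need not carry an arc, but an orbit started in
        \<open>X\<close> never stays at one because its vertices are distinct.\<close>
      moreover have "(s ^^ i) x \<noteq> (s ^^ Suc i) x" using uniq[of x x i "Suc i"] x i by auto
      ultimately show "((s ^^ i) x, (s ^^ Suc i) x) \<in> arcs_ends G"
        using R[of "s ((s ^^ i) x)"] hs[OF d] by auto
    qed auto
  qed
  then obtain p where p: "\<And>x. x \<in> X \<Longrightarrow> awalk x (p x) ((s ^^ n x) x)"
    "\<And>x. x \<in> X \<Longrightarrow> awalk_verts x (p x) = map (\<lambda>i. (s ^^ i) x) [0..<Suc (n x)]" by metis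
  have "apath x (p x) ((s ^^ n x) x)" if "x \<in> X" for x
    unfolding apath_def using p[OF that] uniq[of x x] that
    by (auto simp: distinct_map inj_on_def simp del: upt_Suc)
  moreover have "(s ^^ n x) x \<in> T" if "x \<in> X" for x
    using n(1)[OF that] inV[OF that, of "n x"] T' by (auto simp: D_def)
  moreover have "set (awalk_verts x (p x)) \<inter> set (awalk_verts y (p y)) = {}"
    if "x \<in> X" "y \<in> X" "x \<noteq> y" for x y
    using p(2) uniq[of x y] that by (auto simp: less_Suc_eq_le simp del: upt_Suc)
  ultimately show ?thesis unfolding linked_into_def
    by (intro exI[of _ p] exI[of _ "\<lambda>x. (s ^^ n x) x"]) blast
qed

lemma (in fin_digraph) linked_into_iff_linkable:
  assumes "T \<subseteq> verts G" "X \<subseteq> verts G"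
  shows "linked_into G T X \<longleftrightarrow> linkable (verts G) (arcs_ends G) T X"
  using linked_into_imp_linkable linkable_imp_linked_into[OF _ assms] by (rule iffI)

text \<open>The ground set and the independence predicate are kept apart, so that deleting elements
  changes only \<open>E\<close>. Vertices in \<open>nat\<close> guarantee a fresh one for each
  extension, and a relation \<open>R\<close> can replace the digraph because linkings ignore
  multiplicities of arcs.\<close>

definition gammoid_indep :: "'a set \<Rightarrow> ('a set \<Rightarrow> bool) \<Rightarrow> bool" where
  "gammoid_indep E ind \<longleftrightarrow>
     (\<exists>(V :: nat set) R T \<phi>. finite V \<and> R \<subseteq> V \<times> V \<and> T \<subseteq> V \<and> inj_on \<phi> E \<and> \<phi> ` E \<subseteq> V \<and>
        (\<forall>I\<subseteq>E. ind I \<longleftrightarrow> linkable V R T (\<phi> ` I)))"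

lemma gammoid_iff_gammoid_indep:
  "gammoid M \<longleftrightarrow> matroid M \<and> gammoid_indep (ground M) (\<lambda>I. I \<in> indeps M)"
proof
  assume "gammoid M"
  then obtain G :: "(nat, nat) pre_digraph" and T S f where
    M: "matroid M" and G: "fin_digraph G" and T: "T \<subseteq> verts G" and S: "S \<subseteq> verts G"
    and f: "bij_betw f (ground M) S"
      "\<And>I. I \<subseteq> ground M \<Longrightarrow> I \<in> indeps M \<longleftrightarrow> f ` I \<subseteq> S \<and> linked_into G T (f ` I)"
    unfolding gammoid_def matroid_iso_def linkage_matroid_def by auto
  interpret fin_digraph G by (rule G)
  have img: "f ` ground M = S" using f(1) by (simp add: bij_betw_def)
  have "I \<in> indeps M \<longleftrightarrow> linkable (verts G) (arcs_ends G) T (f ` I)" if I: "I \<subseteq> ground M" for I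
  proof -
    have "f ` I \<subseteq> S" using img I by auto
    then show ?thesis using f(2)[OF I] linked_into_iff_linkable[OF T, of "f ` I"] S by blast
  qed
  moreover have "arcs_ends G \<subseteq> verts G \<times> verts G" by (auto simp: arcs_ends_conv)
  ultimately show "matroid M \<and> gammoid_indep (ground M) (\<lambda>I. I \<in> indeps M)"
    using M T S f(1) img finite_verts unfolding gammoid_indep_def bij_betw_def
    by (intro conjI exI[of _ "verts G"] exI[of _ "arcs_ends G"] exI[of _ T] exI[of _ f]) auto
next
  assume "matroid M \<and> gammoid_indep (ground M) (\<lambda>I. I \<in> indeps M)"
  then obtain V :: "nat set" and R T \<phi> where M: "matroid M" and
    V: "finite V" "R \<subseteq> V \<times> V" "T \<subseteq> V" "inj_on \<phi> (ground M)" "\<phi> ` ground M \<subseteq> V"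
    and ind': "\<forall>I\<subseteq>ground M. I \<in> indeps M \<longleftrightarrow> linkable V R T (\<phi> ` I)"
    unfolding gammoid_indep_def by (elim conjE exE) (rule that)
  have ind: "I \<in> indeps M \<longleftrightarrow> linkable V R T (\<phi> ` I)" if "I \<subseteq> ground M" for I
    using ind' that by simp
  \<comment> \<open>The arc joining a pair of \<open>R\<close> is named by the code of that pair,
    which makes the arc set a set of naturals.\<close>
  define G :: "(nat, nat) pre_digraph" where
    "G = \<lparr>verts = V, arcs = prod_encode ` R, tail = fst \<circ> prod_decode, head = snd \<circ> prod_decode\<rparr>"
  have "finite R" using V(1,2) finite_subset by blast
  interpret fin_digraph G by standard (use V(1,2) \<open>finite R\<close> in \<open>auto simp: G_def\<close>)
  have "arcs_ends G = R" "verts G = V" by (auto simp: arcs_ends_conv G_def image_iff)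
  then have lk: "linked_into G T X \<longleftrightarrow> linkable V R T X" if "X \<subseteq> V" for X
    using linked_into_iff_linkable[of T X] V(3) that by simp
  have "matroid_iso M (linkage_matroid G T (\<phi> ` ground M))"
    unfolding matroid_iso_def linkage_matroid_def
  proof (intro exI[of _ \<phi>] conjI allI impI)
    show "bij_betw \<phi> (ground M) (ground \<lparr>ground = \<phi> ` ground M,
        indeps = {X. X \<subseteq> \<phi> ` ground M \<and> linked_into G T X}\<rparr>)"
      using V(4) by (simp add: inj_on_imp_bij_betw)
    fix I assume I: "I \<subseteq> ground M"
    then have "\<phi> ` I \<subseteq> V" using V(5) by auto
    then show "I \<in> indeps M \<longleftrightarrow> \<phi> ` I \<in> indeps \<lparr>ground = \<phi> ` ground M,
        indeps = {X. X \<subseteq> \<phi> ` ground M \<and> linked_into G T X}\<rparr>"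
      using ind[OF I] lk I by auto
  qed
  moreover have "T \<subseteq> verts G" "\<phi> ` ground M \<subseteq> verts G" using V by (auto simp: G_def)
  ultimately show "gammoid M" unfolding gammoid_def using M fin_digraph_axioms by blast
qed

section \<open>Gammoids under series and parallel extension\<close>

lemma bij_betw_Diff:
  assumes "bij_betw f A B" "C \<subseteq> A"
  shows "bij_betw f (A - C) (B - f ` C)"
  using assms by (auto simp: bij_betw_def inj_on_def)

lemma bij_betw_insert_upd:
  assumes "bij_betw f A B" "a \<notin> A" "b \<notin> B"
  shows "bij_betw (f(a := b)) (insert a A) (insert b B)"
  using assms by (auto simp: bij_betw_def inj_on_def)

lemma linkableI:
  assumes "bij_betw h (V - X) (V - T')" "T' \<subseteq> T" "\<And>w. w \<in> V - X \<Longrightarrow> h w = w \<or> (h w, w) \<in> R"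
  shows "linkable V R T X"
  using assms unfolding linkable_def by blast

lemma linkableE:
  assumes "linkable V R T X"
  obtains h T' where "bij_betw h (V - X) (V - T')" "T' \<subseteq> T"
    "\<And>w. w \<in> V - X \<Longrightarrow> h w = w \<or> (h w, w) \<in> R"
  using assms unfolding linkable_def by blast

text \<open>A vertex off \<open>T\<close> must be a value of the matching. With no arcs at
  \<open>w\<close>, only \<open>w\<close> itself can take this value, so \<open>w\<close> cannot
  start a path and behaves as a loop.\<close>

lemma linkable_isolated:
  assumes "w \<notin> V" "R \<subseteq> V \<times> V" "T \<subseteq> V"
  shows "linkable (insert w V) R T X \<longleftrightarrow> w \<notin> X \<and> linkable V R T X"
proof
  assume "linkable (insert w V) R T X"
  then obtain h T' where h: "bij_betw h (insert w V - X) (insert w V - T')" "T' \<subseteq> T"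
    "\<And>w'. w' \<in> insert w V - X \<Longrightarrow> h w' = w' \<or> (h w', w') \<in> R" by (rule linkableE) blast
  have "w \<in> insert w V - T'" using h(2) assms by auto
  then obtain a where a: "a \<in> insert w V - X" "h a = w"
    using h(1) by (metis bij_betw_imp_surj_on imageE)
  then have "a = w" using h(3)[OF a(1)] assms(1,2) by auto
  then have w: "w \<notin> X" "h w = w" using a by auto
  have "bij_betw h (insert w V - X - {w}) (insert w V - T' - h ` {w})"
    using h(1) w by (intro bij_betw_Diff) auto
  moreover have "insert w V - X - {w} = V - X" "insert w V - T' - h ` {w} = V - T'"
    using assms w h(2) by auto
  ultimately have "bij_betw h (V - X) (V - T')" by simp
  then show "w \<notin> X \<and> linkable V R T X" using w h by (auto intro: linkableI)
next
  assume "w \<notin> X \<and> linkable V R T X"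
  then obtain h T' where w: "w \<notin> X" and h: "bij_betw h (V - X) (V - T')" "T' \<subseteq> T"
    "\<And>w. w \<in> V - X \<Longrightarrow> h w = w \<or> (h w, w) \<in> R" using linkableE by metis
  have "bij_betw (h(w := w)) (insert w (V - X)) (insert w (V - T'))"
    using h(1) assms by (intro bij_betw_insert_upd) auto
  moreover have "insert w (V - X) = insert w V - X" "insert w (V - T') = insert w V - T'"
    using assms w h(2) by auto
  ultimately show "linkable (insert w V) R T X"
    using h by (intro linkableI[of "h(w := w)" _ _ T']) auto
qed

text \<open>As \<open>w\<close> is not in \<open>T\<close>, it is a value of the matching, taken at
  \<open>w\<close> or at \<open>u\<close>. It is taken at \<open>u\<close> exactly when a path
  starts with the arc from \<open>w\<close> to \<open>u\<close>, and the rest of that path starts at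
  \<open>u\<close>. Hence \<open>w\<close> is parallel to \<open>u\<close>.\<close>

lemma linkable_pendant_source:
  assumes "w \<notin> V" "u \<in> V" "R \<subseteq> V \<times> V" "T \<subseteq> V"
  shows "linkable (insert w V) (insert (w, u) R) T X \<longleftrightarrow>
    (if w \<in> X then u \<notin> X \<and> linkable V R T (insert u (X - {w})) else linkable V R T X)"
proof
  assume "linkable (insert w V) (insert (w, u) R) T X"
  then obtain h T' where h: "bij_betw h (insert w V - X) (insert w V - T')" "T' \<subseteq> T"
    "\<And>w'. w' \<in> insert w V - X \<Longrightarrow> h w' = w' \<or> (h w', w') \<in> insert (w, u) R" by (rule linkableE) blast
  have "w \<in> insert w V - T'" using h(2) assms by auto
  then obtain a where a: "a \<in> insert w V - X" "h a = w"
    using h(1) by (metis bij_betw_imp_surj_on imageE)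
  show "if w \<in> X then u \<notin> X \<and> linkable V R T (insert u (X - {w})) else linkable V R T X"
  proof (cases "w \<in> X")
    case True
    then have "a = u" using h(3)[OF a(1)] a assms by auto
    then have u: "u \<notin> X" "h u = w" using a by auto
    have "bij_betw h (insert w V - X - {u}) (insert w V - T' - h ` {u})"
      using h(1) u assms by (intro bij_betw_Diff) auto
    moreover have "insert w V - X - {u} = V - insert u (X - {w})" "insert w V - T' - h ` {u} = V - T'"
      using assms u h(2) True by auto
    ultimately have "bij_betw h (V - insert u (X - {w})) (V - T')" by simp
    moreover have "h v = v \<or> (h v, v) \<in> R" if "v \<in> V - insert u (X - {w})" for v
      using h(3)[of v] that True assms by auto
    ultimately show ?thesis using True u h(2) by (auto intro: linkableI)
  next
    case False
    have w: "h w = w" using h(3)[of w] False assms by auto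
    have "bij_betw h (insert w V - X - {w}) (insert w V - T' - h ` {w})"
      using h(1) False by (intro bij_betw_Diff) auto
    moreover have "insert w V - X - {w} = V - X" "insert w V - T' - h ` {w} = V - T'"
      using assms w h(2) by auto
    ultimately have b: "bij_betw h (V - X) (V - T')" by simp
    moreover have "h v = v \<or> (h v, v) \<in> R" if "v \<in> V - X" for v
    proof -
      have "h v \<in> V" using b that by (auto simp: bij_betw_def)
      then show ?thesis using h(3)[of v] that assms by auto
    qed
    ultimately show ?thesis using False h(2) by (auto intro: linkableI)
  qed
next
  assume L: "if w \<in> X then u \<notin> X \<and> linkable V R T (insert u (X - {w})) else linkable V R T X"
  show "linkable (insert w V) (insert (w, u) R) T X"
  proof (cases "w \<in> X")
    case True
    then obtain h T' where u: "u \<notin> X" and h: "bij_betw h (V - insert u (X - {w})) (V - T')" "T' \<subseteq> T"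
      "\<And>v. v \<in> V - insert u (X - {w}) \<Longrightarrow> h v = v \<or> (h v, v) \<in> R" using L linkableE by metis
    have "bij_betw (h(u := w)) (insert u (V - insert u (X - {w}))) (insert w (V - T'))"
      using h(1) assms by (intro bij_betw_insert_upd) auto
    moreover have "insert u (V - insert u (X - {w})) = insert w V - X" "insert w (V - T') = insert w V - T'"
      using assms True u h(2) by auto
    ultimately show ?thesis using h True
      by (intro linkableI[of "h(u := w)" _ _ T']) auto
  next
    case False
    then obtain h T' where h: "bij_betw h (V - X) (V - T')" "T' \<subseteq> T"
      "\<And>v. v \<in> V - X \<Longrightarrow> h v = v \<or> (h v, v) \<in> R" using L linkableE by metis
    have "bij_betw (h(w := w)) (insert w (V - X)) (insert w (V - T'))"
      using h(1) assms by (intro bij_betw_insert_upd) auto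
    moreover have "insert w (V - X) = insert w V - X" "insert w (V - T') = insert w V - T'"
      using assms False h(2) by auto
    ultimately show ?thesis
      using h by (intro linkableI[of "h(w := w)" _ _ T']) auto
  qed
qed

text \<open>This is the matroid union with a rank-one matroid on \<open>P\<close>: one element of
  \<open>P\<close> may be linked directly to \<open>t\<close>, the others as before. Since no arc of
  \<open>R\<close> enters \<open>P\<close>, only a path starting in \<open>P\<close> can use an arc
  into \<open>t\<close>.\<close>

lemma linkable_new_sink:
  assumes "t \<notin> V" "P \<subseteq> V" "R \<subseteq> V \<times> (V - P)" "T \<subseteq> V" "X \<subseteq> V"
  shows "linkable (insert t V) (R \<union> P \<times> {t}) (insert t T) X \<longleftrightarrow>
    linkable V R T X \<or> (\<exists>p\<in>P \<inter> X. linkable V R T (X - {p}))"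
proof
  assume "linkable (insert t V) (R \<union> P \<times> {t}) (insert t T) X"
  then obtain h T' where h: "bij_betw h (insert t V - X) (insert t V - T')" "T' \<subseteq> insert t T"
    "\<And>w. w \<in> insert t V - X \<Longrightarrow> h w = w \<or> (h w, w) \<in> R \<union> P \<times> {t}" by (rule linkableE) blast
  have t: "t \<in> insert t V - X" using assms by auto
  have ht: "h t \<in> insert t V - T'" using h(1) t by (auto simp: bij_betw_def)
  have b: "bij_betw h (insert t V - X - {t}) (insert t V - T' - h ` {t})"
    using h(1) t by (intro bij_betw_Diff) auto
  have V: "insert t V - X - {t} = V - X" using assms by auto
  have R: "h w = w \<or> (h w, w) \<in> R" if "w \<in> V - X" for w
    using h(3)[of w] that assms by auto
  show "linkable V R T X \<or> (\<exists>p\<in>P \<inter> X. linkable V R T (X - {p}))"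
  proof (cases "h t = t")
    case True
    then have "insert t V - T' - h ` {t} = V - T'" "T' \<subseteq> T" using h(2) ht assms by auto
    then have "linkable V R T X" using b V R by (intro linkableI[of h V X T']) auto
    then show ?thesis ..
  next
    case False
    then have p: "h t \<in> P" using h(3)[OF t] assms by auto
    have "t \<in> T'"
    proof (rule ccontr)
      assume "t \<notin> T'"
      then obtain a where a: "a \<in> insert t V - X" "h a = t"
        using h(1) by (metis Diff_iff bij_betw_imp_surj_on imageE insertI1)
      then show False using h(3)[OF a(1)] False assms by auto
    qed
    \<comment> \<open>No arc enters \<open>P\<close>, so outside \<open>X\<close> the vertex
      \<open>h t\<close> would be matched to itself, and \<open>h\<close> would take that value
      twice.\<close>
    moreover have "h t \<in> X"
    proof (rule ccontr)
      assume n: "h t \<notin> X"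
      then have "h t \<in> V - X" using p assms by auto
      then have "h (h t) = h t" using R p assms by auto
      moreover have "h t \<in> insert t V - X" using n ht by auto
      ultimately show False using h(1) t False by (auto simp: bij_betw_def inj_on_def)
    qed
    \<comment> \<open>Once \<open>h t\<close> no longer starts a path it is matched to itself, and
      the end \<open>t\<close> is given up.\<close>
    moreover have "bij_betw (h(h t := h t)) (insert (h t) (V - X)) (insert (h t) (insert t V - T' - h ` {t}))"
      using b V \<open>h t \<in> X\<close> by (intro bij_betw_insert_upd) auto
    moreover have "insert (h t) (V - X) = V - (X - {h t})" using p assms by auto
    moreover have "insert (h t) (insert t V - T' - h ` {t}) = V - (T' - {t})"
      using p ht \<open>t \<in> T'\<close> assms by auto
    ultimately have "bij_betw (h(h t := h t)) (V - (X - {h t})) (V - (T' - {t}))" by simp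
    then have "linkable V R T (X - {h t})"
      by (rule linkableI) (use h(2) R in auto)
    then show ?thesis using p \<open>h t \<in> X\<close> by auto
  qed
next
  assume "linkable V R T X \<or> (\<exists>p\<in>P \<inter> X. linkable V R T (X - {p}))"
  then show "linkable (insert t V) (R \<union> P \<times> {t}) (insert t T) X"
  proof (elim disjE bexE)
    assume "linkable V R T X"
    then obtain h T' where h: "bij_betw h (V - X) (V - T')" "T' \<subseteq> T"
      "\<And>v. v \<in> V - X \<Longrightarrow> h v = v \<or> (h v, v) \<in> R" using linkableE by metis
    have "bij_betw (h(t := t)) (insert t (V - X)) (insert t (V - T'))"
      using h(1) assms by (intro bij_betw_insert_upd) auto
    moreover have "insert t (V - X) = insert t V - X" "insert t (V - T') = insert t V - T'"
      using assms h(2) by auto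
    ultimately show ?thesis
      using h by (intro linkableI[of "h(t := t)" _ _ T']) auto
  next
    fix p assume p: "p \<in> P \<inter> X" "linkable V R T (X - {p})"
    then obtain h T' where h: "bij_betw h (V - (X - {p})) (V - T')" "T' \<subseteq> T"
      "\<And>v. v \<in> V - (X - {p}) \<Longrightarrow> h v = v \<or> (h v, v) \<in> R" using linkableE by metis
    have pV: "p \<in> V - (X - {p})" using p assms by auto
    then have hp: "h p = p" using h(3)[of p] p assms by auto
    then have pT: "p \<in> V - T'" using h(1) pV by (metis bij_betwE)
    have "bij_betw h (V - (X - {p}) - {p}) (V - T' - h ` {p})"
      using h(1) pV by (intro bij_betw_Diff) auto
    moreover have "V - (X - {p}) - {p} = V - X" using p by auto
    ultimately have "bij_betw (h(t := p)) (insert t (V - X)) (insert p (V - T' - {p}))"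
      using assms hp by (intro bij_betw_insert_upd) auto
    moreover have "insert t (V - X) = insert t V - X" "insert p (V - T' - {p}) = insert t V - insert t T'"
      using assms pT by auto
    ultimately show ?thesis
      using h p by (intro linkableI[of "h(t := p)" _ _ "insert t T'"]) auto
  qed
qed

section \<open>Extending a gammoid by a loop, a coloop, a parallel or a series element\<close>

lemma gammoid_indepE:
  assumes "gammoid_indep E ind"
  obtains V :: "nat set" and R T \<phi> where "finite V" "R \<subseteq> V \<times> V" "T \<subseteq> V" "inj_on \<phi> E" "\<phi> ` E \<subseteq> V"
    "\<And>I. I \<subseteq> E \<Longrightarrow> ind I \<longleftrightarrow> linkable V R T (\<phi> ` I)"
proof -
  obtain V :: "nat set" and R T \<phi> where *: "finite V" "R \<subseteq> V \<times> V" "T \<subseteq> V" "inj_on \<phi> E" "\<phi> ` E \<subseteq> V"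
    "\<forall>I\<subseteq>E. ind I \<longleftrightarrow> linkable V R T (\<phi> ` I)"
    using assms unfolding gammoid_indep_def by (elim conjE exE) (rule that)
  show thesis by (rule that[OF *(1-5)]) (use *(6) in simp)
qed

lemma gammoid_indepI:
  fixes V :: "nat set"
  assumes "finite V" "R \<subseteq> V \<times> V" "T \<subseteq> V" "inj_on \<phi> E" "\<phi> ` E \<subseteq> V"
    "\<And>I. I \<subseteq> E \<Longrightarrow> ind I \<longleftrightarrow> linkable V R T (\<phi> ` I)"
  shows "gammoid_indep E ind"
  unfolding gammoid_indep_def
  by (rule exI[of _ V], rule exI[of _ R], rule exI[of _ T], rule exI[of _ \<phi>]) (use assms in simp)

lemma gammoid_indep_cong:
  assumes "gammoid_indep E ind" "\<And>I. I \<subseteq> E \<Longrightarrow> ind I \<longleftrightarrow> ind' I"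
  shows "gammoid_indep E ind'"
  using assms unfolding gammoid_indep_def by simp

lemma gammoid_indep_empty:
  assumes "ind {}"
  shows "gammoid_indep {} ind"
  by (rule gammoid_indepI[of "{}" "{}" "{}" "\<lambda>_. 0"]) (use assms in \<open>auto simp: linkable_def bij_betw_def\<close>)

lemma gammoid_indep_loop:
  assumes "gammoid_indep E ind" "e \<notin> E"
    and "\<And>I. I \<subseteq> insert e E \<Longrightarrow> ind' I \<longleftrightarrow> e \<notin> I \<and> ind I"
  shows "gammoid_indep (insert e E) ind'"
proof -
  obtain V :: "nat set" and R T \<phi> where V: "finite V" "R \<subseteq> V \<times> V" "T \<subseteq> V" "inj_on \<phi> E" "\<phi> ` E \<subseteq> V"
    and ind: "\<And>I. I \<subseteq> E \<Longrightarrow> ind I \<longleftrightarrow> linkable V R T (\<phi> ` I)"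
    using assms(1) by (rule gammoid_indepE) blast
  obtain w where w: "w \<notin> V" using ex_new_if_finite[OF infinite_UNIV_nat V(1)] by blast
  show ?thesis
  proof (rule gammoid_indepI[of "insert w V" R T "\<phi>(e := w)"])
    show "inj_on (\<phi>(e := w)) (insert e E)" using V w assms(2) by (auto simp: inj_on_def)
    fix I assume I: "I \<subseteq> insert e E"
    have 1: "w \<in> (\<phi>(e := w)) ` I \<longleftrightarrow> e \<in> I" using V(5) w I by (auto simp: image_iff)
    have 2: "(\<phi>(e := w)) ` I = \<phi> ` I" if "e \<notin> I" using that by auto
    have 3: "I \<subseteq> E" if "e \<notin> I" using that I by auto
    show "ind' I \<longleftrightarrow> linkable (insert w V) R T ((\<phi>(e := w)) ` I)"
      unfolding linkable_isolated[OF w V(2,3)] assms(3)[OF I] 1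
      using 2 3 ind[of I] by (cases "e \<in> I") simp_all
  qed (use V in auto)
qed

text \<open>The new element is an isolated vertex \<open>w\<close>, hence a loop, until a new sink
  that only \<open>w\<close> reaches makes it free.\<close>

lemma gammoid_indep_coloop:
  assumes "gammoid_indep E ind" "e \<notin> E"
    and "\<And>I. I \<subseteq> insert e E \<Longrightarrow> ind' I \<longleftrightarrow> ind (I - {e})"
  shows "gammoid_indep (insert e E) ind'"
proof -
  obtain V :: "nat set" and R T \<phi> where V: "finite V" "R \<subseteq> V \<times> V" "T \<subseteq> V" "inj_on \<phi> E" "\<phi> ` E \<subseteq> V"
    and ind: "\<And>I. I \<subseteq> E \<Longrightarrow> ind I \<longleftrightarrow> linkable V R T (\<phi> ` I)"
    using assms(1) by (rule gammoid_indepE) blast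
  obtain w where w: "w \<notin> V" using ex_new_if_finite[OF infinite_UNIV_nat V(1)] by blast
  obtain t where t: "t \<notin> insert w V"
    using ex_new_if_finite[of "insert w V"] infinite_UNIV_nat V(1) by auto
  define \<psi> where "\<psi> = \<phi>(e := w)"
  show ?thesis
  proof (rule gammoid_indepI[of "insert t (insert w V)" "R \<union> {w} \<times> {t}" "insert t T" \<psi>])
    show "inj_on \<psi> (insert e E)" using V w assms(2) by (auto simp: \<psi>_def inj_on_def)
    fix I assume I: "I \<subseteq> insert e E"
    have 1: "e \<in> I \<longleftrightarrow> w \<in> \<psi> ` I" using V(5) w I by (auto simp: \<psi>_def image_iff)
    have 2: "\<psi> ` I - {w} = \<phi> ` (I - {e})" using V(5) w I by (auto simp: \<psi>_def)
    have 3: "\<psi> ` I \<subseteq> insert w V" using V(5) I by (auto simp: \<psi>_def)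
    have 4: "w \<notin> \<phi> ` (I - {e})" using V(5) w I by auto
    show "ind' I \<longleftrightarrow> linkable (insert t (insert w V)) (R \<union> {w} \<times> {t}) (insert t T) (\<psi> ` I)"
    proof -
      have "linkable (insert t (insert w V)) (R \<union> {w} \<times> {t}) (insert t T) (\<psi> ` I) \<longleftrightarrow>
        linkable (insert w V) R T (\<psi> ` I) \<or>
        (\<exists>p\<in>{w} \<inter> \<psi> ` I. linkable (insert w V) R T (\<psi> ` I - {p}))"
        by (rule linkable_new_sink[OF t _ _ _ 3]) (use V(2,3) w in auto)
      also have "\<dots> \<longleftrightarrow> linkable V R T (\<phi> ` (I - {e}))"
      proof (cases "e \<in> I")
        case True
        then have "{w} \<inter> \<psi> ` I = {w}" using 1 by blast
        then show ?thesis using True 1 2 4 by (simp add: linkable_isolated[OF w V(2,3)])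
      next
        case False
        then have "{w} \<inter> \<psi> ` I = {}" "\<psi> ` I = \<phi> ` (I - {e})" using 1 2 by blast+
        then show ?thesis using 4 by (simp add: linkable_isolated[OF w V(2,3)])
      qed
      also have "\<dots> \<longleftrightarrow> ind' I" using assms(3)[OF I] ind[of "I - {e}"] I by blast
      finally show ?thesis by simp
    qed
  qed (use V in \<open>auto simp: \<psi>_def\<close>)
qed

lemma gammoid_indep_parallel:
  assumes "gammoid_indep E ind" "e \<notin> E" "a \<in> E"
    and "\<And>I. I \<subseteq> insert e E \<Longrightarrow>
      ind' I \<longleftrightarrow> (if e \<in> I then a \<notin> I \<and> ind (insert a (I - {e})) else ind I)"
  shows "gammoid_indep (insert e E) ind'"
proof -
  obtain V :: "nat set" and R T \<phi> where V: "finite V" "R \<subseteq> V \<times> V" "T \<subseteq> V" "inj_on \<phi> E" "\<phi> ` E \<subseteq> V"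
    and ind: "\<And>I. I \<subseteq> E \<Longrightarrow> ind I \<longleftrightarrow> linkable V R T (\<phi> ` I)"
    using assms(1) by (rule gammoid_indepE) blast
  obtain w where w: "w \<notin> V" using ex_new_if_finite[OF infinite_UNIV_nat V(1)] by blast
  have u: "\<phi> a \<in> V" using V(5) assms(3) by auto
  have ae: "a \<noteq> e" using assms by auto
  show ?thesis
  proof (rule gammoid_indepI[of "insert w V" "insert (w, \<phi> a) R" T "\<phi>(e := w)"])
    show "inj_on (\<phi>(e := w)) (insert e E)" using V w assms(2) by (auto simp: inj_on_def)
    fix I assume I: "I \<subseteq> insert e E"
    have 1: "w \<in> (\<phi>(e := w)) ` I \<longleftrightarrow> e \<in> I" using V(5) w I by (auto simp: image_iff)
    have 2: "\<phi> a \<in> (\<phi>(e := w)) ` I \<longleftrightarrow> a \<in> I"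
      using V(4) I assms(3) u w ae by (auto simp: inj_on_def image_iff split: if_splits)
    have 3: "insert (\<phi> a) ((\<phi>(e := w)) ` I - {w}) = \<phi> ` (insert a (I - {e}))" using V(5) w I by auto
    have 4: "(\<phi>(e := w)) ` I = \<phi> ` I" if "e \<notin> I" using that by auto
    have 5: "insert a (I - {e}) \<subseteq> E" using I assms(3) by auto
    show "ind' I \<longleftrightarrow> linkable (insert w V) (insert (w, \<phi> a) R) T ((\<phi>(e := w)) ` I)"
      unfolding linkable_pendant_source[OF w u V(2,3)] assms(4)[OF I] 1 2 3
      using ind[OF 5] ind[of I] I 4 by auto
  qed (use V u in auto)
qed

text \<open>Here \<open>ind\<close> is the independence of the matroid with \<open>e\<close>
  contracted. A new source \<open>w\<close> parallel to the vertex of \<open>a\<close> takes over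
  the label \<open>a\<close>, so that no arc enters it; \<open>e\<close> becomes an isolated vertex
  \<open>w'\<close>; a new sink reached from \<open>w\<close> and \<open>w'\<close> then allows one
  of the two elements to be linked in addition.\<close>

lemma gammoid_indep_series:
  assumes "gammoid_indep E ind" "e \<notin> E" "a \<in> E" and mono: "\<And>I. ind I \<Longrightarrow> ind (I - {a})"
    and "\<And>I. I \<subseteq> insert e E \<Longrightarrow> ind' I \<longleftrightarrow> (if e \<in> I then ind (I - {e}) else ind (I - {a}))"
  shows "gammoid_indep (insert e E) ind'"
proof -
  obtain V :: "nat set" and R T \<phi> where V: "finite V" "R \<subseteq> V \<times> V" "T \<subseteq> V" "inj_on \<phi> E" "\<phi> ` E \<subseteq> V"
    and ind: "\<And>I. I \<subseteq> E \<Longrightarrow> ind I \<longleftrightarrow> linkable V R T (\<phi> ` I)"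
    using assms(1) by (rule gammoid_indepE) blast
  obtain w where w: "w \<notin> V" using ex_new_if_finite[OF infinite_UNIV_nat V(1)] by blast
  obtain w' where w': "w' \<notin> insert w V"
    using ex_new_if_finite[of "insert w V"] infinite_UNIV_nat V(1) by auto
  obtain t where t: "t \<notin> insert w' (insert w V)"
    using ex_new_if_finite[of "insert w' (insert w V)"] infinite_UNIV_nat V(1) by auto
  have u: "\<phi> a \<in> V" using V(5) assms(3) by auto
  have ae: "a \<noteq> e" using assms by auto
  define R1 where "R1 = insert (w, \<phi> a) R"
  have R1: "R1 \<subseteq> insert w V \<times> insert w V" using V u by (auto simp: R1_def)
  define \<psi> where "\<psi> = \<phi>(a := w, e := w')"
  have inj: "inj_on \<psi> (insert e E)" using V w w' assms(2) unfolding \<psi>_def by (auto simp: inj_on_def)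
  have \<psi>V: "\<psi> ` E \<subseteq> insert w V" "\<psi> a = w" "\<psi> e = w'" using V(5) ae assms(2) by (auto simp: \<psi>_def)
  have ind1: "linkable (insert w V) R1 T (\<psi> ` K) \<longleftrightarrow> ind K" if K: "K \<subseteq> E" for K
  proof -
    have 1: "w \<in> \<psi> ` K \<longleftrightarrow> a \<in> K"
      using inj K \<psi>V(2) assms(3) by (metis inj_on_image_mem_iff insertI2 subset_insertI2)
    have 2: "\<phi> a \<notin> \<psi> ` K"
      using V(4) K assms(2,3) w u by (auto simp: \<psi>_def inj_on_def image_iff)
    have 3: "insert (\<phi> a) (\<psi> ` K - {w}) = \<phi> ` K" if "a \<in> K"
      using that K assms(2) V(5) w by (auto simp: \<psi>_def)
    have 4: "\<psi> ` K = \<phi> ` K" if "a \<notin> K"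
      using that K assms(2) by (auto simp: \<psi>_def)
    show ?thesis unfolding R1_def linkable_pendant_source[OF w u V(2,3)]
      using 1 2 3 4 ind[OF K] by auto
  qed
  show ?thesis
  proof (rule gammoid_indepI[of "insert t (insert w' (insert w V))" "R1 \<union> {w, w'} \<times> {t}" "insert t T" \<psi>])
    show "R1 \<union> {w, w'} \<times> {t} \<subseteq> insert t (insert w' (insert w V)) \<times> insert t (insert w' (insert w V))"
      using R1 by blast
    fix I assume I: "I \<subseteq> insert e E"
    have X: "\<psi> ` I \<subseteq> insert w' (insert w V)" using \<psi>V I by auto
    have iso: "linkable (insert w' (insert w V)) R1 T Y \<longleftrightarrow> w' \<notin> Y \<and> linkable (insert w V) R1 T Y" for Y
      using linkable_isolated[OF w' R1, of T Y] V(3) by auto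
    have w'I: "w' \<in> \<psi> ` K \<longleftrightarrow> e \<in> K" if "K \<subseteq> insert e E" for K
      using inj that \<psi>V(3) by (metis inj_on_image_mem_iff insertI1)
    have wI: "w \<in> \<psi> ` I \<longleftrightarrow> a \<in> I"
      using inj I \<psi>V(2) assms(3) by (metis inj_on_image_mem_iff insertI2)
    have "\<psi> ` (I - {a}) = \<psi> ` I - \<psi> ` {a}" "\<psi> ` (I - {e}) = \<psi> ` I - \<psi> ` {e}"
      using I assms(3) by (intro inj_on_image_set_diff[OF inj]; auto)+
    then have d: "\<psi> ` I - {w} = \<psi> ` (I - {a})" "\<psi> ` I - {w'} = \<psi> ` (I - {e})"
      using \<psi>V by simp_all
    have l2: "linkable (insert w' (insert w V)) R1 T (\<psi> ` K) \<longleftrightarrow> e \<notin> K \<and> ind K" if "K \<subseteq> insert e E" for K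
      using iso[of "\<psi> ` K"] w'I[OF that] ind1[of K] that by blast
    have "linkable (insert t (insert w' (insert w V))) (R1 \<union> {w, w'} \<times> {t}) (insert t T) (\<psi> ` I) \<longleftrightarrow>
      linkable (insert w' (insert w V)) R1 T (\<psi> ` I) \<or>
      (\<exists>p\<in>{w, w'} \<inter> \<psi> ` I. linkable (insert w' (insert w V)) R1 T (\<psi> ` I - {p}))"
      by (rule linkable_new_sink[OF t _ _ _ X]) (use V(2,3) w w' u in \<open>auto simp: R1_def\<close>)
    \<comment> \<open>An \<open>e\<close> left in the set is a loop of the system without the sink,
      so it has to be the element sent to the new sink.\<close>
    also have "\<dots> \<longleftrightarrow> (e \<notin> I \<and> ind I) \<or> (a \<in> I \<and> e \<notin> I \<and> ind (I - {a})) \<or> (e \<in> I \<and> ind (I - {e}))"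
    proof -
      have "I - {a} \<subseteq> insert e E" "I - {e} \<subseteq> insert e E" using I by auto
      then have "linkable (insert w' (insert w V)) R1 T (\<psi> ` I - {w}) \<longleftrightarrow> e \<notin> I \<and> ind (I - {a})"
        "linkable (insert w' (insert w V)) R1 T (\<psi> ` I - {w'}) \<longleftrightarrow> ind (I - {e})"
        using l2[of "I - {a}"] l2[of "I - {e}"] d ae by simp_all
      then show ?thesis using l2[OF I] wI w'I[OF I] by blast
    qed
    also have "\<dots> \<longleftrightarrow> ind' I"
      using assms(5)[OF I] mono[of I] by (cases "a \<in> I") auto
    finally show "ind' I \<longleftrightarrow>
      linkable (insert t (insert w' (insert w V))) (R1 \<union> {w, w'} \<times> {t}) (insert t T) (\<psi> ` I)" by simp
  qed (use V(1,3) inj \<psi>V in auto)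
qed

section \<open>Base-orderability of gammoids\<close>

text \<open>Used to exchange two matchings along a piece of an alternating path: \<open>g\<close> on
  \<open>D\<close> takes exactly the values that \<open>f\<close> takes on \<open>C\<close>.\<close>

lemma bij_betw_splice:
  assumes "bij_betw f A B" "C \<subseteq> A" "inj_on g D" "g ` D = f ` C" "D \<inter> (A - C) = {}"
  shows "bij_betw (\<lambda>w. if w \<in> D then g w else f w) (D \<union> (A - C)) B"
proof -
  have "bij_betw (\<lambda>w. if w \<in> D then g w else f w) D (f ` C)"
    using assms(3,4) by (simp add: bij_betw_def inj_on_def)
  moreover have "bij_betw (\<lambda>w. if w \<in> D then g w else f w) (A - C) (B - f ` C)"
    using bij_betw_Diff[OF assms(1,2)] assms(5)
    by (subst bij_betw_cong[of _ _ f]) auto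
  ultimately have "bij_betw (\<lambda>w. if w \<in> D then g w else f w) (D \<union> (A - C)) (f ` C \<union> (B - f ` C))"
    by (rule bij_betw_combine) auto
  moreover have "f ` C \<union> (B - f ` C) = B" using assms(1,2) by (auto simp: bij_betw_def)
  ultimately show ?thesis by simp
qed

text \<open>Two linkings are two matchings, and exchanging them along the alternating path that starts
  at \<open>x \<in> B1\<close> moves \<open>x\<close> from \<open>B1\<close> to \<open>B2\<close>.  As \<open>B2\<close> cannot grow, that path ends in an element of
  \<open>B2\<close>, which makes the opposite move.\<close>

lemma linkable_base_orderable:
  assumes "finite V" "B1 \<subseteq> V" "B2 \<subseteq> V" "linkable V R T B1" "linkable V R T B2"
    and max: "\<And>x. x \<in> B1 - B2 \<Longrightarrow> \<not> linkable V R T (insert x B2)"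
  shows "\<exists>f. inj_on f B1 \<and> f ` B1 \<subseteq> B2 \<and> (\<forall>x\<in>B1 \<inter> B2. f x = x) \<and>
    (\<forall>x\<in>B1. linkable V R T (insert (f x) (B1 - {x})) \<and> linkable V R T (insert x (B2 - {f x})))"
proof -
  obtain h1 T1 where h1: "bij_betw h1 (V - B1) (V - T1)" "T1 \<subseteq> T"
    "\<And>w. w \<in> V - B1 \<Longrightarrow> h1 w = w \<or> (h1 w, w) \<in> R" using assms(4) by (rule linkableE) blast
  obtain h2 T2 where h2: "bij_betw h2 (V - B2) (V - T2)" "T2 \<subseteq> T"
    "\<And>w. w \<in> V - B2 \<Longrightarrow> h2 w = w \<or> (h2 w, w) \<in> R" using assms(5) by (rule linkableE) blast
  \<comment> \<open>\<open>s\<close> follows an edge of the second matching and returns along the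
    first. It is used on \<open>D\<close>, where the value of \<open>h2\<close> is also a value of
    \<open>h1\<close>.\<close>
  define D where "D = {w \<in> V - B2. h2 w \<notin> T1}"
  define s where "s = (\<lambda>w. inv_into (V - B1) h1 (h2 w))"
  have D: "w \<in> V - B2" "h2 w \<in> V - T1" if "w \<in> D" for w
    using that h2(1) by (auto simp: D_def bij_betw_def)
  have hs: "h1 (s w) = h2 w" if "w \<in> D" for w
    unfolding s_def using h1(1) D(2)[OF that] by (rule bij_betw_inv_into_right)
  have sV: "s w \<in> V - B1" if "w \<in> D" for w
    unfolding s_def using h1(1) D(2)[OF that] by (metis bij_betw_imp_surj_on inv_into_into)
  have fin: "finite D" using assms(1) by (simp add: D_def)
  have inj2: "inj_on h2 (V - B2)" using h2(1) by (simp add: bij_betw_def)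
  have inj1: "inj_on h1 (V - B1)" using h1(1) by (simp add: bij_betw_def)
  have inj: "inj_on s D"
    by (rule inj_onI) (metis hs inj2 D(1) inj_onD)
  have xn: "x \<notin> s ` D" if "x \<in> B1" for x using sV that by auto
  have "\<forall>x\<in>B1. \<exists>n. (s ^^ n) x \<notin> D \<and> (\<forall>k<n. (s ^^ k) x \<in> D)"
    using orbit_exits[OF fin inj xn] by blast
  then obtain n where n: "\<And>x. x \<in> B1 \<Longrightarrow> (s ^^ n x) x \<notin> D"
      "\<And>x k. x \<in> B1 \<Longrightarrow> k < n x \<Longrightarrow> (s ^^ k) x \<in> D" by metis
  have uniq: "x = y \<and> i = j"
    if "x \<in> B1" "y \<in> B1" "i \<le> n x" "j \<le> n y" "(s ^^ i) x = (s ^^ j) y" for x y i j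
    using orbit_unique[OF inj xn xn, of x y i j] n(2) that by auto
  define f where "f x = (s ^^ n x) x" for x
  have main: "f x \<in> B2 \<and> linkable V R T (insert (f x) (B1 - {x})) \<and> linkable V R T (insert x (B2 - {f x}))"
    if x: "x \<in> B1" for x
  proof -
    \<comment> \<open>The orbit without its end is \<open>A\<close>, matched by \<open>h2\<close>;
      the orbit without its start is \<open>A'\<close>, matched by \<open>h1\<close> onto the same
      values.\<close>
    define A where "A = (\<lambda>i. (s ^^ i) x) ` {..<n x}"
    define A' where "A' = (\<lambda>i. (s ^^ Suc i) x) ` {..<n x}"
    have AD: "A \<subseteq> D" using n(2)[OF x] by (auto simp: A_def)
    have A'V: "A' \<subseteq> V - B1" using sV n(2)[OF x] by (auto simp: A'_def)
    have sA: "s ` A = A'" by (auto simp: A_def A'_def)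
    have h: "h1 ` A' = h2 ` A" using AD hs unfolding sA[symmetric] image_image by (intro image_cong) auto
    have i1: "inj_on h2 A" using inj2 AD D(1) by (meson inj_on_subset subsetI subset_iff)
    have i2: "inj_on h1 A'" using inj1 A'V by (meson inj_on_subset)
    define y where "y = f x"
    have un: "insert y A = insert x A'"
    proof -
      have "insert y A = (\<lambda>i. (s ^^ i) x) ` {..<Suc (n x)}"
        by (simp add: y_def f_def A_def lessThan_Suc)
      also have "\<dots> = insert x A'"
        by (simp add: A'_def lessThan_Suc_eq_insert_0 image_image)
      finally show ?thesis .
    qed
    have un': "y \<in> insert x A'" "A \<subseteq> insert x A'" "A' \<subseteq> insert y A" "x \<in> insert y A"
      using un by (metis insertI1, metis subset_insertI, metis subset_insertI, metis insertI1)
    have fA: "y \<notin> A" using n(1)[OF x] AD by (auto simp: y_def f_def)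
    have xA': "x \<notin> A'" using A'V x by auto
    have fV: "y \<in> V" using un'(1) A'V x assms(2) by blast
    have AV: "A \<subseteq> V - B2" using AD D(1) by blast
    \<comment> \<open>If the orbit ended outside \<open>B2\<close>, the value \<open>h2 y\<close>
      would lie in \<open>T1\<close>. Switching the second matching to the first along the orbit
      would then link \<open>insert x B2\<close>, with \<open>h2 y\<close> as an additional
      end.\<close>
    have fB2: "y \<in> B2"
    proof (rule ccontr)
      assume nB: "y \<notin> B2"
      then have fT: "h2 y \<in> T1" using n(1)[OF x] fV by (auto simp: D_def y_def f_def)
      have xB: "x \<notin> B2" using un'(4) nB AV by blast
      have b: "bij_betw h2 (V - B2 - {y}) (V - T2 - {h2 y})"
        using bij_betw_Diff[OF h2(1), of "{y}"] nB fV by simp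
      have "A' \<inter> (V - B2 - {y} - A) = {}" "A \<subseteq> V - B2 - {y}" using un'(3) AV fA by blast+
      then have "bij_betw (\<lambda>w. if w \<in> A' then h1 w else h2 w)
          (A' \<union> (V - B2 - {y} - A)) (V - T2 - {h2 y})"
        by (intro bij_betw_splice[OF b _ i2 h])
      moreover have "A' \<union> (V - B2 - {y} - A) = V - insert x B2"
        using un' AV nB fV xA' by blast
      moreover have "V - T2 - {h2 y} = V - insert (h2 y) T2" by blast
      ultimately have "bij_betw (\<lambda>w. if w \<in> A' then h1 w else h2 w) (V - insert x B2) (V - insert (h2 y) T2)"
        by simp
      then have "linkable V R T (insert x B2)"
      proof (rule linkableI)
        show "insert (h2 y) T2 \<subseteq> T" using fT h1(2) h2(2) by blast
        fix w assume "w \<in> V - insert x B2"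
        then show "(if w \<in> A' then h1 w else h2 w) = w \<or> (if w \<in> A' then h1 w else h2 w, w) \<in> R"
          using h1(3)[of w] h2(3)[of w] A'V by (cases "w \<in> A'") auto
      qed
      then show False using max x xB by blast
    qed
    have e1: "A \<inter> (V - B1 - A') = {}" using un'(2) x by blast
    have "bij_betw (\<lambda>w. if w \<in> A then h2 w else h1 w) (A \<union> (V - B1 - A')) (V - T1)"
      by (rule bij_betw_splice[OF h1(1) A'V i1 h[symmetric] e1])
    moreover have "A \<union> (V - B1 - A') = V - insert y (B1 - {x})"
      using un' AV A'V fA xA' x assms(2) by blast
    ultimately have "bij_betw (\<lambda>w. if w \<in> A then h2 w else h1 w) (V - insert y (B1 - {x})) (V - T1)" by simp
    then have L1: "linkable V R T (insert y (B1 - {x}))"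
    proof (rule linkableI)
      fix w assume "w \<in> V - insert y (B1 - {x})"
      then have "w \<in> A \<or> w \<in> V - B1" using un'(4) by blast
      then show "(if w \<in> A then h2 w else h1 w) = w \<or> (if w \<in> A then h2 w else h1 w, w) \<in> R"
        using h1(3)[of w] h2(3)[of w] AV by (cases "w \<in> A") auto
    qed (rule h1(2))
    have e2: "A' \<inter> (V - B2 - A) = {}" using un'(3) fB2 by blast
    have "bij_betw (\<lambda>w. if w \<in> A' then h1 w else h2 w) (A' \<union> (V - B2 - A)) (V - T2)"
      by (rule bij_betw_splice[OF h2(1) AV i2 h e2])
    moreover have "A' \<union> (V - B2 - A) = V - insert x (B2 - {y})"
      using un' AV A'V fA xA' x fB2 assms(3) by blast
    ultimately have "bij_betw (\<lambda>w. if w \<in> A' then h1 w else h2 w) (V - insert x (B2 - {y})) (V - T2)"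
      by simp
    then have L2: "linkable V R T (insert x (B2 - {y}))"
    proof (rule linkableI)
      fix w assume "w \<in> V - insert x (B2 - {y})"
      then have "w \<in> A' \<or> w \<in> V - B2" using un'(1) by blast
      then show "(if w \<in> A' then h1 w else h2 w) = w \<or> (if w \<in> A' then h1 w else h2 w, w) \<in> R"
        using h1(3)[of w] h2(3)[of w] A'V by (cases "w \<in> A'") auto
    qed (rule h2(2))
    show ?thesis using fB2 L1 L2 by (simp add: y_def)
  qed
  \<comment> \<open>Orbits from different starting points never meet, so their ends differ.\<close>
  have "inj_on f B1" using uniq unfolding f_def by (auto simp: inj_on_def)
  moreover have "f x = x" if "x \<in> B1 \<inter> B2" for x
  proof -
    \<comment> \<open>A common element lies outside \<open>D\<close>, so its orbit stops at
      once.\<close>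
    have "n x = 0" using n(2)[of x 0] that by (auto simp: D_def)
    then show ?thesis by (simp add: f_def)
  qed
  ultimately show ?thesis using main by (intro exI[of _ f]) auto
qed

lemma gammoid_indep_base_orderable:
  assumes "gammoid_indep E ind" "B1 \<subseteq> E" "B2 \<subseteq> E" "ind B1" "ind B2"
    and max: "\<And>x. x \<in> B1 - B2 \<Longrightarrow> \<not> ind (insert x B2)"
  shows "\<exists>f. inj_on f B1 \<and> f ` B1 \<subseteq> B2 \<and> (\<forall>x\<in>B1 \<inter> B2. f x = x) \<and>
    (\<forall>x\<in>B1. ind (insert (f x) (B1 - {x})) \<and> ind (insert x (B2 - {f x})))"
proof -
  obtain V :: "nat set" and R T \<phi> where V: "finite V" "R \<subseteq> V \<times> V" "T \<subseteq> V" "inj_on \<phi> E" "\<phi> ` E \<subseteq> V"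
    and ind: "\<And>I. I \<subseteq> E \<Longrightarrow> ind I \<longleftrightarrow> linkable V R T (\<phi> ` I)"
    using assms(1) by (rule gammoid_indepE) blast
  have sub: "\<phi> ` B1 \<subseteq> V" "\<phi> ` B2 \<subseteq> V" using assms(2,3) V(5) by auto
  have lk: "linkable V R T (\<phi> ` B1)" "linkable V R T (\<phi> ` B2)" using ind assms(2-5) by auto
  have "\<not> linkable V R T (insert y (\<phi> ` B2))" if y: "y \<in> \<phi> ` B1 - \<phi> ` B2" for y
  proof -
    obtain x where x: "x \<in> B1 - B2" "y = \<phi> x" using y by blast
    then have "insert x B2 \<subseteq> E" using assms(2,3) by auto
    then show ?thesis using max[OF x(1)] ind[of "insert x B2"] x by simp
  qed
  then obtain g where g: "inj_on g (\<phi> ` B1)" "g ` \<phi> ` B1 \<subseteq> \<phi> ` B2"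
    "\<And>y. y \<in> \<phi> ` B1 \<inter> \<phi> ` B2 \<Longrightarrow> g y = y"
    "\<And>y. y \<in> \<phi> ` B1 \<Longrightarrow> linkable V R T (insert (g y) (\<phi> ` B1 - {y}))"
    "\<And>y. y \<in> \<phi> ` B1 \<Longrightarrow> linkable V R T (insert y (\<phi> ` B2 - {g y}))"
    using linkable_base_orderable[OF V(1) sub lk] by (metis (no_types, lifting))
  define f where "f x = inv_into B2 \<phi> (g (\<phi> x))" for x
  have \<phi>f: "\<phi> (f x) = g (\<phi> x)" and fB: "f x \<in> B2" if "x \<in> B1" for x
    using g(2) that by (auto simp: f_def f_inv_into_f inv_into_into image_subset_iff)
  have "inj_on f B1"
  proof (rule inj_onI)
    fix x y assume *: "x \<in> B1" "y \<in> B1" "f x = f y"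
    then have "g (\<phi> x) = g (\<phi> y)" using \<phi>f by metis
    then have "\<phi> x = \<phi> y" using g(1) * by (auto dest: inj_onD)
    then show "x = y" using V(4) * assms(2) by (auto dest: inj_onD)
  qed
  moreover have "ind (insert (f x) (B1 - {x})) \<and> ind (insert x (B2 - {f x}))" if x: "x \<in> B1" for x
  proof -
    have "\<phi> ` (B1 - {x}) = \<phi> ` B1 - \<phi> ` {x}" "\<phi> ` (B2 - {f x}) = \<phi> ` B2 - \<phi> ` {f x}"
      using assms(2,3) x fB[OF x] by (intro inj_on_image_set_diff[OF V(4)]; auto)+
    moreover have "insert (f x) (B1 - {x}) \<subseteq> E" "insert x (B2 - {f x}) \<subseteq> E"
      using assms(2,3) x fB[OF x] by auto
    ultimately show ?thesis using g(4,5)[of "\<phi> x"] x ind \<phi>f[OF x] by simp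
  qed
  moreover have "f x = x" if x: "x \<in> B1 \<inter> B2" for x
  proof -
    have "\<phi> (f x) = \<phi> x" using g(3)[of "\<phi> x"] \<phi>f[of x] x by auto
    then show ?thesis using V(4) fB[of x] x assms(2,3) by (auto dest: inj_onD)
  qed
  ultimately show ?thesis using fB by (intro exI[of _ f]) auto
qed

section \<open>Cycle spaces of binary matroids\<close>

definition cycle_space :: "nat \<Rightarrow> (nat \<Rightarrow> 'a \<Rightarrow> bit) \<Rightarrow> 'a set \<Rightarrow> 'a set set" where
  "cycle_space m A E = {Y. Y \<subseteq> E \<and> (\<forall>i<m. (\<Sum>e\<in>Y. A i e) = 0)}"

text \<open>A linear subspace of the power of GF(2) over \<open>E\<close>, with vectors as sets and
  sums as symmetric differences. Working with the space instead of a matrix lets minors be taken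
  without row operations.\<close>

definition bin_space :: "'a set \<Rightarrow> 'a set set \<Rightarrow> bool" where
  "bin_space E V \<longleftrightarrow> finite E \<and> V \<subseteq> Pow E \<and> {} \<in> V \<and> (\<forall>Y\<in>V. \<forall>Z\<in>V. sym_diff Y Z \<in> V)"

definition cycle_free :: "'a set set \<Rightarrow> 'a set \<Rightarrow> bool" where
  "cycle_free V I \<longleftrightarrow> (\<forall>Y\<in>V. Y \<subseteq> I \<longrightarrow> Y = {})"

lemma bin_spaceD:
  assumes "bin_space E V"
  shows "finite E" "Y \<in> V \<Longrightarrow> Y \<subseteq> E" "{} \<in> V" "Y \<in> V \<Longrightarrow> Z \<in> V \<Longrightarrow> sym_diff Y Z \<in> V"
    "Y \<in> V \<Longrightarrow> finite Y"
proof -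
  show "finite E" "{} \<in> V" "Y \<in> V \<Longrightarrow> Y \<subseteq> E" "Y \<in> V \<Longrightarrow> Z \<in> V \<Longrightarrow> sym_diff Y Z \<in> V"
    using assms by (auto simp: bin_space_def)
  then show "Y \<in> V \<Longrightarrow> finite Y" by (metis finite_subset)
qed

lemma cycle_free_mono: "cycle_free V I \<Longrightarrow> J \<subseteq> I \<Longrightarrow> cycle_free V J"
  unfolding cycle_free_def by blast

lemma cycle_freeD: "cycle_free V I \<Longrightarrow> Y \<in> V \<Longrightarrow> Y \<subseteq> I \<Longrightarrow> Y = {}"
  unfolding cycle_free_def by blast

lemma sum_sym_diff_bit:
  fixes f :: "'a \<Rightarrow> bit"
  assumes "finite Y" "finite Z"
  shows "sum f (sym_diff Y Z) = sum f Y + sum f Z"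
proof -
  have "sum f Y = sum f (Y - Z) + sum f (Y \<inter> Z)"
    using assms by (metis Int_Diff_disjoint Un_Diff_Int finite_Diff finite_Int sum.union_disjoint Int_commute)
  moreover have "sum f Z = sum f (Z - Y) + sum f (Y \<inter> Z)"
    using assms by (metis Int_Diff_disjoint Un_Diff_Int finite_Diff finite_Int sum.union_disjoint Int_commute)
  moreover have "sum f (sym_diff Y Z) = sum f (Y - Z) + sum f (Z - Y)"
    using assms by (intro sum.union_disjoint) auto
  ultimately show ?thesis
    by (cases "sum f (Y \<inter> Z)"; cases "sum f (Y - Z)"; cases "sum f (Z - Y)") simp_all
qed

lemma bin_space_cycle_space:
  assumes "finite E"
  shows "bin_space E (cycle_space m A E)"
proof -
  have "sym_diff Y Z \<in> cycle_space m A E" if "Y \<in> cycle_space m A E" "Z \<in> cycle_space m A E" for Y Z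
  proof -
    have "finite Y" "finite Z" using that assms finite_subset by (auto simp: cycle_space_def)
    then show ?thesis using that sum_sym_diff_bit[of Y Z] by (auto simp: cycle_space_def)
  qed
  then show ?thesis using assms unfolding bin_space_def by (auto simp: cycle_space_def)
qed

text \<open>A vector of coefficients over GF(2) is the indicator of its support, so linear relations
  within \<open>I\<close> are the cycles inside \<open>I\<close>.\<close>

lemma indep_columns_iff_cycle_free:
  assumes "finite E" "I \<subseteq> E"
  shows "indep_columns m A I \<longleftrightarrow> cycle_free (cycle_space m A E) I"
proof
  have fin: "finite I" using assms finite_subset by blast
  {
    assume L: "indep_columns m A I"
    show "cycle_free (cycle_space m A E) I"
      unfolding cycle_free_def
    proof (intro ballI impI)
      fix Y assume Y: "Y \<in> cycle_space m A E" "Y \<subseteq> I"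
      define c :: "'a \<Rightarrow> bit" where "c e = (if e \<in> Y then 1 else 0)" for e
      have "(\<Sum>e\<in>I. c e * A i e) = (\<Sum>e\<in>Y. A i e)" for i
        using Y(2) fin by (intro sum.mono_neutral_cong_right) (auto simp: c_def)
      then have "\<forall>i<m. (\<Sum>e\<in>I. c e * A i e) = 0"
        using Y(1) by (simp add: cycle_space_def del: mult_bit_eq_and)
      then have "\<forall>e\<in>I. c e = 0" using L unfolding indep_columns_def by blast
      then show "Y = {}" using Y(2) by (auto simp: c_def split: if_splits)
    qed
  next
    assume R: "cycle_free (cycle_space m A E) I"
    show "indep_columns m A I"
      unfolding indep_columns_def
    proof (intro allI impI)
      fix c :: "'a \<Rightarrow> bit" assume c: "\<forall>i<m. (\<Sum>e\<in>I. c e * A i e) = 0"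
      have "(\<Sum>e\<in>I. c e * A i e) = (\<Sum>e\<in>{e\<in>I. c e = 1}. A i e)" for i
        using fin by (intro sum.mono_neutral_cong_right) auto
      then have "{e\<in>I. c e = 1} \<in> cycle_space m A E"
        using c assms(2) by (simp add: cycle_space_def subset_iff del: mult_bit_eq_and)
      then have "{e\<in>I. c e = 1} = {}" by (rule cycle_freeD[OF R]) auto
      then show "\<forall>e\<in>I. c e = 0" by auto
    qed
  }
qed

text \<open>If no element of \<open>J\<close> can be added to \<open>I\<close>, then every subset of \<open>J\<close> is congruent modulo \<open>V\<close> to a
  subset of \<open>I\<close>, and distinct subsets of \<open>J\<close> to distinct ones.\<close>

lemma cycle_free_augment:
  assumes V: "bin_space E V" and I: "cycle_free V I" "I \<subseteq> E" and J: "cycle_free V J" "J \<subseteq> E"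
    and "card I < card J"
  shows "\<exists>x\<in>J - I. cycle_free V (insert x I)"
proof (rule ccontr)
  assume "\<not> ?thesis"
  then have "\<forall>x\<in>J - I. \<exists>Y\<in>V. Y \<subseteq> insert x I \<and> Y \<noteq> {}" unfolding cycle_free_def by blast
  then obtain c where c: "\<And>x. x \<in> J - I \<Longrightarrow> c x \<in> V \<and> c x \<subseteq> insert x I \<and> c x \<noteq> {}" by metis
  have xc: "x \<in> c x" if "x \<in> J - I" for x
    using c[OF that] cycle_freeD[OF I(1), of "c x"] by blast
  have fin: "finite I" "finite J" using I J bin_spaceD(1)[OF V] finite_subset by blast+
  \<comment> \<open>Each element of \<open>Z\<close> outside \<open>I\<close> is removed by adding
    its cycle \<open>c x\<close>, whose other elements all lie in \<open>I\<close>.\<close>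
  have ex: "\<exists>W. W \<subseteq> I \<and> sym_diff Z W \<in> V" if "Z \<subseteq> I \<union> J" for Z
    using that
  proof (induction "card (Z - I)" arbitrary: Z)
    case 0
    have "finite (Z - I)" using 0 fin finite_subset[of "Z - I" J] by auto
    then have "Z \<subseteq> I" using 0 by auto
    then show ?case using bin_spaceD(3)[OF V] by (intro exI[of _ Z]) auto
  next
    case (Suc n)
    have fZ: "finite (Z - I)" using Suc fin finite_subset[of "Z - I" J] by auto
    obtain x where x: "x \<in> Z - I" using Suc(2) by (metis card.empty equals0I nat.distinct(1))
    then have xJ: "x \<in> J - I" using Suc.prems by auto
    have "sym_diff Z (c x) - I = Z - I - {x}" using c[OF xJ] xc[OF xJ] x by auto
    then have "n = card (sym_diff Z (c x) - I)" using Suc(2) x fZ by simp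
    moreover have "sym_diff Z (c x) \<subseteq> I \<union> J" using Suc.prems c[OF xJ] xJ by auto
    ultimately obtain W where W: "W \<subseteq> I" "sym_diff (sym_diff Z (c x)) W \<in> V"
      using Suc.hyps(1) by blast
    have "sym_diff (sym_diff (sym_diff Z (c x)) W) (c x) \<in> V"
      using bin_spaceD(4)[OF V W(2)] c[OF xJ] by blast
    moreover have "sym_diff (sym_diff (sym_diff Z (c x)) W) (c x) = sym_diff Z W" by auto
    ultimately show ?case using W(1) by auto
  qed
  then have "\<forall>Z\<in>Pow J. \<exists>W. W \<subseteq> I \<and> sym_diff Z W \<in> V" by auto
  then obtain W where W: "\<And>Z. Z \<subseteq> J \<Longrightarrow> W Z \<subseteq> I" "\<And>Z. Z \<subseteq> J \<Longrightarrow> sym_diff Z (W Z) \<in> V"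
    by (metis PowI)
  have "inj_on W (Pow J)"
  proof (rule inj_onI)
    fix Z Z' assume *: "Z \<in> Pow J" "Z' \<in> Pow J" "W Z = W Z'"
    have "sym_diff (sym_diff Z (W Z)) (sym_diff Z' (W Z')) \<in> V"
      using * by (intro bin_spaceD(4)[OF V] W(2)) auto
    moreover have "sym_diff (sym_diff Z (W Z)) (sym_diff Z' (W Z')) = sym_diff Z Z'" using *(3) by auto
    ultimately have "sym_diff Z Z' = {}" using cycle_freeD[OF J(1), of "sym_diff Z Z'"] * by auto
    then show "Z = Z'" by auto
  qed
  moreover have "W ` Pow J \<subseteq> Pow I" using W(1) by auto
  ultimately have "card (Pow J) \<le> card (Pow I)" using fin by (intro card_inj_on_le) auto
  then have "card J \<le> card I" using fin by (simp add: card_Pow)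
  then show False using assms by simp
qed

section \<open>The matroid of a binary matrix and the effect of splitting on its cycles\<close>

lemma indeps_vector_matroid:
  assumes "finite E"
  shows "I \<in> indeps (vector_matroid m A E) \<longleftrightarrow> I \<subseteq> E \<and> cycle_free (cycle_space m A E) I"
  using indep_columns_iff_cycle_free[OF assms] by (simp add: vector_matroid_def cong: conj_cong)

lemma ground_vector_matroid [simp]: "ground (vector_matroid m A E) = E"
  by (simp add: vector_matroid_def)

lemma matroid_vector_matroid:
  assumes "finite E"
  shows "matroid (vector_matroid m A E)"
proof -
  have aug: "\<exists>x\<in>J - I. insert x I \<in> indeps (vector_matroid m A E)"
    if "I \<in> indeps (vector_matroid m A E)" "J \<in> indeps (vector_matroid m A E)" "card I < card J" for I J
    using that cycle_free_augment[OF bin_space_cycle_space[OF assms], of m A I J]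
    by (auto simp: indeps_vector_matroid[OF assms])
  have sub: "J \<in> indeps (vector_matroid m A E)" if "I \<in> indeps (vector_matroid m A E)" "J \<subseteq> I" for I J
    using that cycle_free_mono by (auto simp: indeps_vector_matroid[OF assms])
  have "{} \<in> indeps (vector_matroid m A E)"
    by (auto simp: indeps_vector_matroid[OF assms] cycle_free_def)
  moreover have "I \<subseteq> E" if "I \<in> indeps (vector_matroid m A E)" for I
    using that by (simp add: indeps_vector_matroid[OF assms])
  ultimately show ?thesis unfolding matroid_def ground_vector_matroid
    using assms sub aug by simp
qed

text \<open>\<open>X\<close> is arbitrary here, so that deleting elements of the ground set does not
  force \<open>X\<close> to be trimmed; the second \<open>- {q}\<close> protects the parity from a
  \<open>q\<close> in \<open>X\<close>.\<close>

definition split_space :: "'a set set \<Rightarrow> 'a set \<Rightarrow> 'a \<Rightarrow> 'a set set" where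
  "split_space V X q = {Y. Y - {q} \<in> V \<and> (q \<in> Y \<longleftrightarrow> odd (card (Y \<inter> X - {q})))}"

lemma of_nat_bit_eq_0_iff: "(of_nat n :: bit) = 0 \<longleftrightarrow> even n"
proof (induction n)
  case (Suc n)
  then show ?case by (cases "of_nat n :: bit") auto
qed simp

text \<open>The column of \<open>q\<close> vanishes in the old rows, which therefore test
  \<open>Y - {q}\<close>. The new row counts the elements of \<open>Y\<close> in
  \<open>insert q X\<close> modulo 2, and \<open>q\<close> must correct an odd count.\<close>

lemma cycle_space_splitting:
  assumes "finite E" "q \<notin> E" "X \<subseteq> E"
  shows "cycle_space (Suc m) (splitting_matrix m A X q) (insert q E) = split_space (cycle_space m A E) X q"
proof -
  have "(\<forall>i<Suc m. (\<Sum>e\<in>Y. splitting_matrix m A X q i e) = 0) \<longleftrightarrow>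
      (\<forall>i<m. (\<Sum>e\<in>Y - {q}. A i e) = 0) \<and> (q \<in> Y \<longleftrightarrow> odd (card (Y \<inter> X - {q})))"
    if Y: "Y \<subseteq> insert q E" for Y
  proof -
    have fin: "finite Y" using assms Y finite_subset by auto
    have 1: "(\<Sum>e\<in>Y. splitting_matrix m A X q i e) = (\<Sum>e\<in>Y - {q}. A i e)" if "i < m" for i
      using fin that by (intro sum.mono_neutral_cong_right) (auto simp: splitting_matrix_def)
    have "(\<Sum>e\<in>Y. splitting_matrix m A X q m e) = (\<Sum>e\<in>Y \<inter> insert q X. 1)"
      using fin by (intro sum.mono_neutral_cong_right) (auto simp: splitting_matrix_def)
    also have "\<dots> = of_nat (card (Y \<inter> insert q X))" by simp
    finally have 2: "(\<Sum>e\<in>Y. splitting_matrix m A X q m e) = 0 \<longleftrightarrow> even (card (Y \<inter> insert q X))"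
      by (simp add: of_nat_bit_eq_0_iff)
    have 3: "card (Y \<inter> insert q X) = (if q \<in> Y then Suc (card (Y \<inter> X - {q})) else card (Y \<inter> X - {q}))"
    proof (cases "q \<in> Y")
      case True
      then have "Y \<inter> insert q X = insert q (Y \<inter> X - {q})" by auto
      then show ?thesis using True fin card_insert_disjoint[of "Y \<inter> X - {q}" q] by simp
    next
      case False
      then have "Y \<inter> insert q X = Y \<inter> X - {q}" by auto
      then show ?thesis using False by simp
    qed
    show ?thesis unfolding All_less_Suc 2 using 1 3 by (cases "q \<in> Y") auto
  qed
  moreover have "Y \<subseteq> insert q E \<longleftrightarrow> Y - {q} \<subseteq> E" for Y by auto
  ultimately show ?thesis unfolding cycle_space_def split_space_def by blast
qed

section \<open>Cycle spaces without a \<open>G7\<close> minor\<close>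

text \<open>The set \<open>C\<close> is contracted, and \<open>e0\<close>, ..., \<open>e4\<close>
  follow the numbering of the edges of \<open>G7\<close>. Modulo \<open>C\<close>, the pair
  \<open>e0\<close>, \<open>e2\<close> is a basis of these five, and the traces of
  \<open>Y1\<close>, \<open>Y2\<close>, \<open>Y3\<close> are the fundamental cycles of
  \<open>e1\<close>, \<open>e3\<close>, \<open>e4\<close>.\<close>

definition G7_config :: "'a set \<Rightarrow> 'a set set \<Rightarrow> bool" where
  "G7_config E V \<longleftrightarrow> (\<exists>C e0 e1 e2 e3 e4 Y1 Y2 Y3.
     C \<subseteq> E \<and> distinct [e0, e1, e2, e3, e4] \<and> {e0, e1, e2, e3, e4} \<inter> C = {} \<and>
     cycle_free V (C \<union> {e0, e2}) \<and> Y1 \<in> V \<and> Y2 \<in> V \<and> Y3 \<in> V \<and>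
     Y1 - C = {e0, e1} \<and> Y2 - C = {e2, e3} \<and> Y3 - C = {e0, e2, e4})"

lemma G7_configI:
  assumes "C \<subseteq> E" "distinct [e0, e1, e2, e3, e4]" "{e0, e1, e2, e3, e4} \<inter> C = {}"
    "cycle_free V (C \<union> {e0, e2})" "Y1 \<in> V" "Y2 \<in> V" "Y3 \<in> V"
    "Y1 - C = {e0, e1}" "Y2 - C = {e2, e3}" "Y3 - C = {e0, e2, e4}"
  shows "G7_config E V"
  unfolding G7_config_def
  by (rule exI[of _ C], rule exI[of _ e0], rule exI[of _ e1], rule exI[of _ e2], rule exI[of _ e3],
      rule exI[of _ e4], rule exI[of _ Y1], rule exI[of _ Y2], rule exI[of _ Y3]) (intro conjI assms)

lemma G7_configE:
  assumes "G7_config E V"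
  obtains C e0 e1 e2 e3 e4 Y1 Y2 Y3 where
    "C \<subseteq> E" "distinct [e0, e1, e2, e3, e4]" "{e0, e1, e2, e3, e4} \<inter> C = {}"
    "cycle_free V (C \<union> {e0, e2})" "Y1 \<in> V" "Y2 \<in> V" "Y3 \<in> V"
    "Y1 - C = {e0, e1}" "Y2 - C = {e2, e3}" "Y3 - C = {e0, e2, e4}"
  using assms unfolding G7_config_def by (elim exE conjE) (rule that)

text \<open>Relative to a maximal cycle-free set \<open>F\<close> let \<open>S f\<close> be the set of those elements whose fundamental
  cycle contains \<open>f\<close>.  Two distinct sets \<open>S f\<close>, \<open>S f'\<close> with at least two elements each that meet
  produce \<open>G7\<close>, so here the sets \<open>S f\<close> are pairwise disjoint.\<close>

lemma exists_three_parallel: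
  assumes V: "bin_space E V" and ne: "E \<noteq> {}" and no_G7: "\<not> G7_config E V"
    and no_loop: "\<And>e. {e} \<notin> V"
    and no_coloop: "\<And>e. e \<in> E \<Longrightarrow> \<exists>Y\<in>V. e \<in> Y"
    and no_series: "\<And>e e'. e \<in> E \<Longrightarrow> e' \<in> E \<Longrightarrow> e \<noteq> e' \<Longrightarrow> \<exists>Y\<in>V. (e \<in> Y) \<noteq> (e' \<in> Y)"
  shows "\<exists>a b c. distinct [a, b, c] \<and> {a, b} \<in> V \<and> {a, c} \<in> V"
proof -
  note VD = bin_spaceD[OF V]
  have fin: "finite {F. F \<subseteq> E \<and> cycle_free V F}" using VD(1) by auto
  have mem0: "{} \<in> {F. F \<subseteq> E \<and> cycle_free V F}" by (auto simp: cycle_free_def)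
  obtain F where F': "F \<in> {F. F \<subseteq> E \<and> cycle_free V F}"
      "\<forall>K\<in>{F. F \<subseteq> E \<and> cycle_free V F}. F \<subseteq> K \<longrightarrow> F = K"
    using finite_has_maximal2[OF fin mem0] by (elim bexE conjE) (rule that)
  have F: "F \<subseteq> E" "cycle_free V F" using F'(1) by auto
  have Fmax: "F = K" if "K \<subseteq> E" "cycle_free V K" "F \<subseteq> K" for K
    using F'(2) that by auto
  have "\<exists>Y\<in>V. Y \<subseteq> insert e F \<and> e \<in> Y" if e: "e \<in> E - F" for e
  proof -
    have "\<not> cycle_free V (insert e F)" using Fmax[of "insert e F"] e F(1) by blast
    then obtain Y where "Y \<in> V" "Y \<subseteq> insert e F" "Y \<noteq> {}" unfolding cycle_free_def by blast
    then show ?thesis using cycle_freeD[OF F(2), of Y] by blast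
  qed
  then obtain c where c: "\<And>e. e \<in> E - F \<Longrightarrow> c e \<in> V" "\<And>e. e \<in> E - F \<Longrightarrow> c e \<subseteq> insert e F"
    "\<And>e. e \<in> E - F \<Longrightarrow> e \<in> c e" by metis
  define S where "S f = {e \<in> E - F. f \<in> c e}" for f
  have finS: "finite (S f)" for f using VD(1) by (simp add: S_def)
  \<comment> \<open>\<open>Y\<close> is the sum of the fundamental cycles of its elements outside
    \<open>F\<close>; the induction subtracts one of them at a time.\<close>
  have mem: "f \<in> Y \<longleftrightarrow> odd (card (S f \<inter> Y))" if f: "f \<in> F" and "Y \<in> V" for f Y
    using that(2)
  proof (induction "card (Y - F)" arbitrary: Y)
    case 0
    then have "Y \<subseteq> F" using VD(5)[of Y] by auto
    then have "Y = {}" using cycle_freeD[OF F(2)] 0 by blast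
    then show ?case by simp
  next
    case (Suc n)
    have fY: "finite (Y - F)" using VD(5)[of Y] Suc.prems by simp
    obtain e where e: "e \<in> Y - F" using Suc(2) by (metis card.empty equals0I nat.distinct(1))
    then have eE: "e \<in> E - F" using VD(2)[OF Suc.prems] by auto
    define Z where "Z = sym_diff Y (c e)"
    have "Z - F = Y - F - {e}" unfolding Z_def using c(2,3)[OF eE] e by blast
    then have "n = card (Z - F)" using Suc(2) e fY by simp
    moreover have "Z \<in> V" unfolding Z_def using VD(4)[OF Suc.prems c(1)[OF eE]] .
    ultimately have IH: "f \<in> Z \<longleftrightarrow> odd (card (S f \<inter> Z))" using Suc.hyps(1) by blast
    have SZ: "S f \<inter> Z = S f \<inter> Y - {e}" unfolding Z_def S_def using c(2,3)[OF eE] e by blast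
    show ?case
    proof (cases "f \<in> c e")
      case True
      then have "e \<in> S f \<inter> Y" using e eE by (simp add: S_def)
      then have "card (S f \<inter> Y) = Suc (card (S f \<inter> Z))"
        unfolding SZ using finS by (metis card.remove finite_Int)
      moreover have "f \<in> Z \<longleftrightarrow> f \<notin> Y" using True unfolding Z_def by blast
      ultimately show ?thesis using IH by simp
    next
      case False
      then have "e \<notin> S f" by (simp add: S_def)
      then have "S f \<inter> Z = S f \<inter> Y" unfolding SZ by blast
      moreover have "f \<in> Z \<longleftrightarrow> f \<in> Y" using False unfolding Z_def by blast
      ultimately show ?thesis using IH by simp
    qed
  qed
  \<comment> \<open>An empty \<open>S f\<close> would make \<open>f\<close> a coloop, and a
    singleton would put \<open>f\<close> in series with its only element.\<close>
  have S2: "\<exists>z\<in>S f. z \<noteq> x" if f: "f \<in> F" for f x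
  proof (rule ccontr)
    assume "\<not> ?thesis"
    then have sub: "S f \<subseteq> {x}" by blast
    show False
    proof (cases "x \<in> S f")
      case True
      then have "S f = {x}" using sub by blast
      then have "f \<in> Y \<longleftrightarrow> x \<in> Y" if "Y \<in> V" for Y
        using mem[OF f that] by (cases "x \<in> Y") auto
      moreover have "x \<in> E" "f \<in> E" "f \<noteq> x" using True f F(1) by (auto simp: S_def)
      ultimately show False using no_series[of f x] by blast
    next
      case False
      then have "S f = {}" using sub by blast
      then have "f \<notin> Y" if "Y \<in> V" for Y using mem[OF f that] by simp
      then show False using no_coloop[of f] f F(1) by blast
    qed
  qed
  have half: False
    if f: "f \<in> F" "f' \<in> F" "f \<noteq> f'" and x: "x \<in> S f" "x \<in> S f'" and y: "y \<in> S f" "y \<notin> S f'" for f f' x y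
  proof -
    \<comment> \<open>All of \<open>F\<close> except \<open>f\<close> and \<open>f'\<close> is
      contracted. Modulo \<open>C\<close>, the element \<open>y\<close> is parallel to
      \<open>f\<close>, and \<open>x\<close> completes a triangle with \<open>f\<close> and
      \<open>f'\<close>. If \<open>z\<close> is parallel to \<open>f'\<close>, this is already
      \<open>G7\<close>.\<close>
    obtain z where z: "z \<in> S f'" "z \<noteq> x" using S2[OF f(2)] by blast
    define C where "C = F - {f, f'}"
    have E: "x \<in> E - F" "y \<in> E - F" "z \<in> E - F" using x y z by (auto simp: S_def)
    have "f \<in> c x" "f' \<in> c x" "f \<in> c y" "f' \<notin> c y" "f' \<in> c z" using x y z by (auto simp: S_def)
    note cc = this
    have d: "distinct [f, f', x, y, z]" using f x y z E by auto
    have C: "C \<subseteq> E" using F(1) by (auto simp: C_def)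
    have t: "c x - C = {f, x, f'}" "c y - C = {f, y}"
      unfolding C_def using c(2,3)[OF E(1)] c(2,3)[OF E(2)] cc f E by blast+
    show False
    proof (cases "f \<in> c z")
      case False
      have "c z - C = {f', z}" unfolding C_def using c(2,3)[OF E(3)] cc f E False by blast
      moreover have "C \<union> {f, f'} = F" using f by (auto simp: C_def)
      moreover have "{f, y, f', z, x} \<inter> C = {}" using E by (auto simp: C_def)
      moreover have "c x - C = {f, f', x}" using t(1) by auto
      ultimately have "G7_config E V"
        using C d c(1) E F(2) t by (intro G7_configI[of C E f y f' z x V "c y" "c z" "c x"]) auto
      then show False using no_G7 by blast
    next
      case True
      \<comment> \<open>Now the traces of \<open>c x\<close> and \<open>c z\<close> differ only in
        \<open>x\<close> and \<open>z\<close>. These two form the second parallel pair, and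
        \<open>f'\<close> takes the part of \<open>e4\<close>.\<close>
      have tz: "c z - C = {f, z, f'}" unfolding C_def using c(2,3)[OF E(3)] cc f E True by blast
      have "sym_diff (c x) (c z) - C = sym_diff (c x - C) (c z - C)" by blast
      then have xz: "sym_diff (c x) (c z) - C = {x, z}" using tz t(1) d by auto
      have cf: "cycle_free V (C \<union> {f, x})"
        unfolding cycle_free_def
      proof (intro ballI impI)
        fix Y assume Y: "Y \<in> V" "Y \<subseteq> C \<union> {f, x}"
        have "f' \<notin> Y" using Y(2) d by (auto simp: C_def)
        have "x \<notin> Y"
        proof
          assume "x \<in> Y"
          have "sym_diff Y (c x) \<subseteq> F" using \<open>x \<in> Y\<close> Y(2) c(2,3)[OF E(1)] f by (auto simp: C_def)
          then have "sym_diff Y (c x) = {}" using cycle_freeD[OF F(2)] VD(4)[OF Y(1) c(1)[OF E(1)]] by blast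
          then show False using cc(2) \<open>f' \<notin> Y\<close> by blast
        qed
        then have "Y \<subseteq> F" using Y(2) f by (auto simp: C_def)
        then show "Y = {}" using cycle_freeD[OF F(2) Y(1)] by blast
      qed
      have "{f, y, x, z, f'} \<inter> C = {}" using E by (auto simp: C_def)
      then have "G7_config E V"
        using C d c(1) E cf t xz VD(4)
        by (intro G7_configI[of C E f y x z f' V "c y" "sym_diff (c x) (c z)" "c x"]) auto
      then show False using no_G7 by blast
    qed
  qed
  have disj: "f = f'" if f: "f \<in> F" "f' \<in> F" and x: "x \<in> S f" "x \<in> S f'" for f f' x
  proof (rule ccontr)
    assume ff: "f \<noteq> f'"
    have "S f = S f'"
    proof (rule ccontr)
      assume "S f \<noteq> S f'"
      then consider y where "y \<in> S f" "y \<notin> S f'" | y where "y \<in> S f'" "y \<notin> S f" by blast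
      then show False using half f x ff by cases metis+
    qed
    then have "f \<in> Y \<longleftrightarrow> f' \<in> Y" if "Y \<in> V" for Y using mem f that by simp
    then show False using no_series[of f f'] f ff F(1) by blast
  qed
  have "F \<noteq> {}"
  proof
    assume "F = {}"
    then obtain e where "e \<in> E - F" using ne by blast
    then have "c e = {e}" using c[of e] \<open>F = {}\<close> by blast
    then show False using no_loop c(1) \<open>e \<in> E - F\<close> by metis
  qed
  then obtain f where f: "f \<in> F" by blast
  obtain x where x: "x \<in> S f" using S2[OF f] by blast
  obtain y where y: "y \<in> S f" "y \<noteq> x" using S2[OF f] by blast
  \<comment> \<open>Disjointness leaves \<open>f\<close> as the only element of \<open>F\<close> in
    the fundamental cycle of \<open>x\<close>.\<close>
  have pair: "{f, x} \<in> V" if x: "x \<in> S f" for x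
  proof -
    have xE: "x \<in> E - F" "f \<in> c x" using x by (auto simp: S_def)
    have "f' = f" if "f' \<in> c x" "f' \<in> F" for f'
      using disj[OF that(2) f, of x] x xE that by (simp add: S_def)
    then have "c x = {f, x}" using c(2,3)[OF xE(1)] xE(2) by blast
    then show ?thesis using c(1)[OF xE(1)] by simp
  qed
  have "x \<notin> F" "y \<notin> F" using x y by (auto simp: S_def)
  then have "distinct [f, x, y]" using f y by auto
  then show ?thesis using pair[OF x] pair[OF y(1)] by blast
qed

section \<open>Split spaces and the four reductions in terms of cycles\<close>

lemma odd_card_sym_diff:
  assumes "finite A" "finite B"
  shows "odd (card (sym_diff A B)) \<longleftrightarrow> odd (card A) \<noteq> odd (card B)"
proof -
  have "card A = card (A - B) + card (A \<inter> B)"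
    using assms(1) by (metis Diff_disjoint Int_Diff_disjoint Un_Diff_Int add.commute card_Un_disjoint finite_Diff finite_Int inf_commute)
  moreover have "card B = card (B - A) + card (A \<inter> B)"
    using assms(2) by (metis Diff_disjoint Int_Diff_disjoint Un_Diff_Int add.commute card_Un_disjoint finite_Diff finite_Int inf_commute)
  moreover have "card (sym_diff A B) = card (A - B) + card (B - A)"
    using assms by (intro card_Un_disjoint) auto
  ultimately show ?thesis by presburger
qed

lemma split_spaceD:
  assumes "Y \<in> split_space V X q"
  shows "Y - {q} \<in> V" "q \<in> Y \<longleftrightarrow> odd (card (Y \<inter> X - {q}))"
  using assms by (auto simp only: split_space_def mem_Collect_eq)

lemma split_spaceI:
  assumes "Y - {q} \<in> V" "q \<in> Y \<longleftrightarrow> odd (card (Y \<inter> X - {q}))"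
  shows "Y \<in> split_space V X q"
  using assms unfolding split_space_def mem_Collect_eq by (rule conjI)

lemma bin_space_split_space:
  assumes V: "bin_space E V"
  shows "bin_space (insert q E) (split_space V X q)"
proof -
  note VD = bin_spaceD[OF V]
  have "sym_diff Y Z \<in> split_space V X q" if "Y \<in> split_space V X q" "Z \<in> split_space V X q" for Y Z
  proof -
    have YZ: "Y - {q} \<in> V" "Z - {q} \<in> V" using split_spaceD(1) that by metis+
    have "sym_diff Y Z - {q} = sym_diff (Y - {q}) (Z - {q})" by blast
    then have 1: "sym_diff Y Z - {q} \<in> V" using VD(4)[OF YZ] by simp
    have "finite (Y \<inter> X - {q})" "finite (Z \<inter> X - {q})"
      using VD(5)[OF YZ(1)] VD(5)[OF YZ(2)] by (auto simp: Int_Diff)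
    moreover have "sym_diff Y Z \<inter> X - {q} = sym_diff (Y \<inter> X - {q}) (Z \<inter> X - {q})" by blast
    ultimately have "odd (card (sym_diff Y Z \<inter> X - {q})) \<longleftrightarrow>
        odd (card (Y \<inter> X - {q})) \<noteq> odd (card (Z \<inter> X - {q}))"
      using odd_card_sym_diff by metis
    then have "q \<in> sym_diff Y Z \<longleftrightarrow> odd (card (sym_diff Y Z \<inter> X - {q}))"
      unfolding split_spaceD(2)[OF that(1), symmetric] split_spaceD(2)[OF that(2), symmetric] by blast
    then show ?thesis using 1 by (intro split_spaceI)
  qed
  moreover have "Y \<subseteq> insert q E" if "Y \<in> split_space V X q" for Y
    using VD(2)[OF split_spaceD(1)[OF that]] by blast
  moreover have "{} \<in> split_space V X q" using VD(3) by (simp add: split_space_def)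
  ultimately show ?thesis using VD(1) unfolding bin_space_def by simp blast
qed

lemma gammoid_indep_cycle_free_loop:
  assumes "e \<in> E" "{e} \<in> W" "gammoid_indep (E - {e}) (cycle_free W)"
  shows "gammoid_indep E (cycle_free W)"
proof -
  have "gammoid_indep (insert e (E - {e})) (cycle_free W)"
  proof (rule gammoid_indep_loop[OF assms(3)])
    fix I
    have "e \<notin> I" if "cycle_free W I" using cycle_freeD[OF that assms(2)] by blast
    then show "cycle_free W I \<longleftrightarrow> e \<notin> I \<and> cycle_free W I" by blast
  qed simp
  then show ?thesis using assms(1) by (simp add: insert_absorb)
qed

lemma gammoid_indep_cycle_free_coloop:
  assumes "e \<in> E" "\<And>Y. Y \<in> W \<Longrightarrow> e \<notin> Y" "gammoid_indep (E - {e}) (cycle_free W)"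
  shows "gammoid_indep E (cycle_free W)"
proof -
  have "gammoid_indep (insert e (E - {e})) (cycle_free W)"
  proof (rule gammoid_indep_coloop[OF assms(3)])
    fix I
    have "Y \<subseteq> I - {e} \<longleftrightarrow> Y \<subseteq> I" if "Y \<in> W" for Y using assms(2)[OF that] by blast
    then show "cycle_free W I \<longleftrightarrow> cycle_free W (I - {e})" by (simp add: cycle_free_def)
  qed simp
  then show ?thesis using assms(1) by (simp add: insert_absorb)
qed

text \<open>Adding the cycle \<open>{a, e}\<close> to a cycle that contains exactly one of
  \<open>a\<close> and \<open>e\<close> exchanges the two, so either can stand for the other in an
  independent set.\<close>

lemma gammoid_indep_cycle_free_parallel:
  assumes W: "bin_space E W" and "e \<in> E" "a \<in> E" "a \<noteq> e" "{a, e} \<in> W"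
    and "gammoid_indep (E - {e}) (cycle_free W)"
  shows "gammoid_indep E (cycle_free W)"
proof -
  have "gammoid_indep (insert e (E - {e})) (cycle_free W)"
  proof (rule gammoid_indep_parallel[OF assms(6)])
    fix I
    show "cycle_free W I \<longleftrightarrow>
      (if e \<in> I then a \<notin> I \<and> cycle_free W (insert a (I - {e})) else cycle_free W I)"
    proof (cases "e \<in> I")
      case True
      have "a \<notin> I \<and> cycle_free W (insert a (I - {e}))" if L: "cycle_free W I"
      proof
        show "a \<notin> I" using cycle_freeD[OF L assms(5)] True by blast
        show "cycle_free W (insert a (I - {e}))" unfolding cycle_free_def
        proof (intro ballI impI)
          fix Y assume Y: "Y \<in> W" "Y \<subseteq> insert a (I - {e})"
          show "Y = {}"
          proof (cases "a \<in> Y")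
            case True2: True
            have "sym_diff Y {a, e} \<in> W" using bin_spaceD(4)[OF W Y(1) assms(5)] .
            moreover have "sym_diff Y {a, e} \<subseteq> I" "e \<in> sym_diff Y {a, e}"
              using Y(2) True True2 assms(4) by blast+
            ultimately show ?thesis using cycle_freeD[OF L] by blast
          next
            case False
            then show ?thesis using cycle_freeD[OF L Y(1)] Y(2) by blast
          qed
        qed
      qed
      moreover have "cycle_free W I" if R: "a \<notin> I" "cycle_free W (insert a (I - {e}))"
        unfolding cycle_free_def
      proof (intro ballI impI)
        fix Y assume Y: "Y \<in> W" "Y \<subseteq> I"
        show "Y = {}"
        proof (cases "e \<in> Y")
          case True2: True
          have "sym_diff Y {a, e} \<in> W" using bin_spaceD(4)[OF W Y(1) assms(5)] .
          moreover have "sym_diff Y {a, e} \<subseteq> insert a (I - {e})" "a \<in> sym_diff Y {a, e}"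
            using Y(2) True2 assms(4) R(1) by blast+
          ultimately show ?thesis using cycle_freeD[OF R(2)] by blast
        next
          case False
          then show ?thesis using cycle_freeD[OF R(2) Y(1)] Y(2) by blast
        qed
      qed
      ultimately have "cycle_free W I \<longleftrightarrow> a \<notin> I \<and> cycle_free W (insert a (I - {e}))" by blast
      then show ?thesis using True by simp
    qed simp
  qed (use assms in auto)
  then show ?thesis using assms(2) by (simp add: insert_absorb)
qed

text \<open>Removing \<open>e\<close> from every cycle is contraction of \<open>e\<close>. As
  \<open>a\<close> and \<open>e\<close> occur only together, a set that misses one of them contains
  only cycles that miss both.\<close>

lemma gammoid_indep_cycle_free_series:
  assumes "e \<in> E" "a \<in> E" "a \<noteq> e" and ser: "\<And>Y. Y \<in> W \<Longrightarrow> a \<in> Y \<longleftrightarrow> e \<in> Y"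
    and "gammoid_indep (E - {e}) (cycle_free ((\<lambda>Y. Y - {e}) ` W))"
  shows "gammoid_indep E (cycle_free W)"
proof -
  have "gammoid_indep (insert e (E - {e})) (cycle_free W)"
  proof (rule gammoid_indep_series[OF assms(5)])
    fix I
    have "cycle_free W I \<longleftrightarrow> cycle_free ((\<lambda>Y. Y - {e}) ` W) (I - {e})" if "e \<in> I"
    proof -
      have "(Y \<subseteq> I \<longrightarrow> Y = {}) \<longleftrightarrow> (Y - {e} \<subseteq> I - {e} \<longrightarrow> Y - {e} = {})" if "Y \<in> W" for Y
        using ser[OF that] \<open>e \<in> I\<close> assms(3) by blast
      then show ?thesis unfolding cycle_free_def by simp
    qed
    moreover have "cycle_free W I \<longleftrightarrow> cycle_free ((\<lambda>Y. Y - {e}) ` W) (I - {a})" if "e \<notin> I"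
    proof -
      have "(Y \<subseteq> I \<longrightarrow> Y = {}) \<longleftrightarrow> (Y - {e} \<subseteq> I - {a} \<longrightarrow> Y - {e} = {})" if "Y \<in> W" for Y
        using ser[OF that] \<open>e \<notin> I\<close> assms(3) by blast
      then show ?thesis unfolding cycle_free_def by simp
    qed
    ultimately show "cycle_free W I \<longleftrightarrow> (if e \<in> I then cycle_free ((\<lambda>Y. Y - {e}) ` W) (I - {e})
        else cycle_free ((\<lambda>Y. Y - {e}) ` W) (I - {a}))" by simp
  next
    show "\<And>I. cycle_free ((\<lambda>Y. Y - {e}) ` W) I \<Longrightarrow> cycle_free ((\<lambda>Y. Y - {e}) ` W) (I - {a})"
      by (rule cycle_free_mono) auto
  qed (use assms in auto)
  then show ?thesis using assms(1) by (simp add: insert_absorb)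
qed

section \<open>Deletion and contraction of one element in a cycle space\<close>

lemma bin_space_delete:
  assumes "bin_space E V"
  shows "bin_space (E - {e}) {Y \<in> V. e \<notin> Y}"
proof -
  note VD = bin_spaceD[OF assms]
  have "sym_diff Y Z \<in> {Y \<in> V. e \<notin> Y}" if "Y \<in> {Y \<in> V. e \<notin> Y}" "Z \<in> {Y \<in> V. e \<notin> Y}" for Y Z
    using that VD(4)[of Y Z] by blast
  moreover have "{Y \<in> V. e \<notin> Y} \<subseteq> Pow (E - {e})" using VD(2) by blast
  ultimately show ?thesis using VD(1,3) unfolding bin_space_def by blast
qed

lemma bin_space_contract:
  assumes "bin_space E V"
  shows "bin_space (E - {e}) ((\<lambda>Y. Y - {e}) ` V)"
proof -
  have "sym_diff (Y - {e}) (Z - {e}) \<in> (\<lambda>Y. Y - {e}) ` V" if "Y \<in> V" "Z \<in> V" for Y Z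
  proof -
    have "sym_diff (Y - {e}) (Z - {e}) = sym_diff Y Z - {e}" by blast
    then show ?thesis using bin_spaceD(4)[OF assms that] by auto
  qed
  moreover have "{} \<in> (\<lambda>Y. Y - {e}) ` V" using bin_spaceD(3)[OF assms] by force
  ultimately show ?thesis using assms unfolding bin_space_def by auto
qed

lemma G7_config_delete:
  assumes "G7_config (E - {e}) {Y \<in> V. e \<notin> Y}"
  shows "G7_config E V"
  using assms
proof (rule G7_configE)
  fix C e0 e1 e2 e3 e4 Y1 Y2 Y3
  assume C: "C \<subseteq> E - {e}" and "distinct [e0, e1, e2, e3, e4]" "{e0, e1, e2, e3, e4} \<inter> C = {}"
    and cf: "cycle_free {Y \<in> V. e \<notin> Y} (C \<union> {e0, e2})"
    and Y: "Y1 \<in> {Y \<in> V. e \<notin> Y}" "Y2 \<in> {Y \<in> V. e \<notin> Y}" "Y3 \<in> {Y \<in> V. e \<notin> Y}"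
    and t: "Y1 - C = {e0, e1}" "Y2 - C = {e2, e3}" "Y3 - C = {e0, e2, e4}"
  note * = this
  have "e \<notin> C \<union> {e0, e2}" using C Y(1,2) t(1,2) by blast
  then have "cycle_free V (C \<union> {e0, e2})" using cf unfolding cycle_free_def by blast
  then show ?thesis using * by (intro G7_configI[of C E e0 e1 e2 e3 e4 V Y1 Y2 Y3]) auto
qed

text \<open>With \<open>e\<close> contracted as well, \<open>insert e C\<close> takes the place of
  \<open>C\<close>. Cycle-freeness is kept since removing \<open>e\<close> cannot empty a nonempty
  cycle: together with \<open>e\<close> it contains \<open>a\<close>.\<close>

lemma G7_config_contract_series:
  assumes ser: "\<And>Y. Y \<in> V \<Longrightarrow> a \<in> Y \<longleftrightarrow> e \<in> Y" and "a \<noteq> e" "e \<in> E"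
    and "G7_config (E - {e}) ((\<lambda>Y. Y - {e}) ` V)"
  shows "G7_config E V"
  using assms(4)
proof (rule G7_configE)
  fix C e0 e1 e2 e3 e4 Y1 Y2 Y3
  assume C: "C \<subseteq> E - {e}" and d: "distinct [e0, e1, e2, e3, e4]" and ec: "{e0, e1, e2, e3, e4} \<inter> C = {}"
    and cf: "cycle_free ((\<lambda>Y. Y - {e}) ` V) (C \<union> {e0, e2})"
    and Y: "Y1 \<in> (\<lambda>Y. Y - {e}) ` V" "Y2 \<in> (\<lambda>Y. Y - {e}) ` V" "Y3 \<in> (\<lambda>Y. Y - {e}) ` V"
    and t: "Y1 - C = {e0, e1}" "Y2 - C = {e2, e3}" "Y3 - C = {e0, e2, e4}"
  obtain Z1 Z2 Z3 where Z: "Z1 \<in> V" "Z2 \<in> V" "Z3 \<in> V" and YZ: "Y1 = Z1 - {e}" "Y2 = Z2 - {e}" "Y3 = Z3 - {e}"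
    using Y by blast
  have "cycle_free V (insert e C \<union> {e0, e2})" unfolding cycle_free_def
  proof (intro ballI impI)
    fix Z assume Z: "Z \<in> V" "Z \<subseteq> insert e C \<union> {e0, e2}"
    have "Z - {e} = {}"
      by (rule cycle_freeD[OF cf]) (use Z in auto)
    then show "Z = {}" using ser[OF Z(1)] assms(2) by blast
  qed
  moreover have "Z1 - insert e C = {e0, e1}" "Z2 - insert e C = {e2, e3}" "Z3 - insert e C = {e0, e2, e4}"
    using t unfolding YZ by blast+
  moreover have "e \<notin> {e0, e1, e2, e3, e4}" using t unfolding YZ by blast
  ultimately show ?thesis using C d ec Z assms(3)
    by (intro G7_configI[of "insert e C" E e0 e1 e2 e3 e4 V Z1 Z2 Z3]) auto
qed

text \<open>Every cycle contains both or neither of \<open>a\<close> and \<open>e\<close>. If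
  \<open>e\<close> lies in \<open>X\<close>, its contribution to the parity is therefore passed on
  to \<open>a\<close> by toggling \<open>a\<close> in \<open>X\<close>.\<close>

lemma split_space_contract_series:
  assumes V: "bin_space E V" and q: "q \<notin> E" and ser: "\<And>Y. Y \<in> V \<Longrightarrow> a \<in> Y \<longleftrightarrow> e \<in> Y"
    and "a \<in> E" "e \<in> E" "a \<noteq> e"
  shows "(\<lambda>Y. Y - {e}) ` split_space V X q =
    split_space ((\<lambda>Y. Y - {e}) ` V) (if e \<in> X then sym_diff X {a} else X) q"
proof -
  define X' where "X' = (if e \<in> X then sym_diff X {a} else X)"
  have qe: "q \<noteq> e" "q \<noteq> a" using q assms by auto
  have par: "odd (card ((Y - {e}) \<inter> X' - {q})) \<longleftrightarrow> odd (card (Y \<inter> X - {q}))" if Y: "Y - {q} \<in> V" for Y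
  proof -
    have ae: "a \<in> Y \<longleftrightarrow> e \<in> Y" using ser[OF Y] qe by auto
    have fin: "finite (Y \<inter> X - {q})" using bin_spaceD(5)[OF V Y] by (auto simp: Int_Diff)
    show ?thesis
    proof (cases "e \<in> X \<and> e \<in> Y")
      case True
      then have "(Y - {e}) \<inter> X' - {q} = sym_diff (Y \<inter> X - {q}) {a, e}"
        using ae qe assms(6) unfolding X'_def by auto
      moreover have "card {a, e} = 2" using assms(6) by simp
      ultimately show ?thesis using odd_card_sym_diff[OF fin, of "{a, e}"] by simp
    next
      case False
      then have "(Y - {e}) \<inter> X' - {q} = Y \<inter> X - {q}"
        using ae qe assms(6) unfolding X'_def by auto
      then show ?thesis by simp
    qed
  qed
  have "Y - {e} \<in> split_space ((\<lambda>Y. Y - {e}) ` V) X' q" if "Y \<in> split_space V X q" for Y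
  proof -
    note Y = split_spaceD[OF that]
    have "Y - {e} - {q} = Y - {q} - {e}" by blast
    then have "Y - {e} - {q} \<in> (\<lambda>Y. Y - {e}) ` V" using Y(1) by blast
    moreover have "q \<in> Y - {e} \<longleftrightarrow> odd (card ((Y - {e}) \<inter> X' - {q}))"
      unfolding par[OF Y(1)] Y(2)[symmetric] using qe by blast
    ultimately show ?thesis by (rule split_spaceI)
  qed
  moreover have "Z \<in> (\<lambda>Y. Y - {e}) ` split_space V X q" if Z: "Z \<in> split_space ((\<lambda>Y. Y - {e}) ` V) X' q" for Z
  proof -
    obtain Y where Y: "Y \<in> V" "Z - {q} = Y - {e}" using split_spaceD(1)[OF Z] by blast
    have "q \<notin> Y" using bin_spaceD(2)[OF V Y(1)] q by auto
    \<comment> \<open>\<open>Y\<close> is a cycle of the unsplit space; \<open>q\<close> is put back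
      exactly when \<open>Z\<close> contains it, and \<open>par\<close> carries the parity
      over.\<close>
    define U where "U = (if q \<in> Z then insert q Y else Y)"
    have U: "U - {q} = Y" "q \<in> U \<longleftrightarrow> q \<in> Z" using \<open>q \<notin> Y\<close> by (auto simp: U_def)
    have "e \<notin> Z" using Y(2) qe by blast
    then have ZU: "Z = U - {e}" using Y(2) U qe by blast
    have UV: "U - {q} \<in> V" using U(1) Y(1) by simp
    have "q \<in> U \<longleftrightarrow> odd (card (U \<inter> X - {q}))"
      using split_spaceD(2)[OF Z] par[OF UV] U(2) unfolding ZU[symmetric] by blast
    with UV have "U \<in> split_space V X q" by (rule split_spaceI)
    then show ?thesis using ZU by blast
  qed
  ultimately show ?thesis unfolding X'_def by blast
qed

text \<open>Deleting \<open>e\<close> from the splitting gives the splitting of the deletion, and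
  contracting one element of a series pair gives the splitting of the contraction with an adjusted
  \<open>X\<close>, which is why \<open>X\<close> varies in the induction. Neither reduction creates
  a \<open>G7\<close> configuration.\<close>

lemma gammoid_indep_split_space:
  assumes "bin_space E V" "q \<notin> E" "\<not> G7_config E V"
  shows "gammoid_indep (insert q E) (cycle_free (split_space V X q))"
  using assms
proof (induction "card E" arbitrary: E V X rule: less_induct)
  case less
  note V = less.prems(1) and q = less.prems(2)
  note VD = bin_spaceD[OF V]
  let ?W = "split_space V X q"
  have W: "bin_space (insert q E) ?W" using V by (rule bin_space_split_space)
  have del: "gammoid_indep (insert q E - {e}) (cycle_free ?W)" if e: "e \<in> E" for e
  proof -
    have "gammoid_indep (insert q (E - {e})) (cycle_free (split_space {Y \<in> V. e \<notin> Y} X q))"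
    proof (rule less.hyps)
      show "card (E - {e}) < card E" using e VD(1) by (rule card_Diff1_less[rotated])
      show "bin_space (E - {e}) {Y \<in> V. e \<notin> Y}" using V by (rule bin_space_delete)
      show "\<not> G7_config (E - {e}) {Y \<in> V. e \<notin> Y}" 
        using less.prems(3) by (rule contrapos_nn) (rule G7_config_delete)
    qed (use q in auto)
    moreover have "cycle_free (split_space {Y \<in> V. e \<notin> Y} X q) I \<longleftrightarrow> cycle_free ?W I"
      if I: "I \<subseteq> insert q (E - {e})" for I
    proof -
      have "Y \<in> split_space {Y \<in> V. e \<notin> Y} X q \<longleftrightarrow> Y \<in> ?W" if "Y \<subseteq> I" for Y
      proof -
        have "e \<notin> Y" using that I e q by blast
        then show ?thesis by (simp add: split_space_def)
      qed
      then show ?thesis unfolding cycle_free_def by metis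
    qed
    moreover have "insert q (E - {e}) = insert q E - {e}" using e q by auto
    ultimately show ?thesis by (metis (no_types, lifting) gammoid_indep_cong)
  qed
  show ?case
  proof (cases "E = {}")
    case True
    \<comment> \<open>Only \<open>q\<close> is left, and it is a coloop: the empty cycle has even
      parity.\<close>
    have "gammoid_indep {} (cycle_free ?W)"
      by (rule gammoid_indep_empty) (simp add: cycle_free_def)
    moreover have "q \<notin> Y" if "Y \<in> ?W" for Y
    proof -
      have "Y \<inter> X - {q} = {}" using VD(2)[OF split_spaceD(1)[OF that]] True by blast
      then show ?thesis using split_spaceD(2)[OF that] by (metis card.empty even_zero)
    qed
    ultimately show ?thesis
      using gammoid_indep_cycle_free_coloop[of q "insert q E" ?W] True by simp
  next
    case False
    have "(\<exists>e. {e} \<in> V) \<or> (\<exists>e\<in>E. \<forall>Y\<in>V. e \<notin> Y) \<or>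
      (\<exists>a\<in>E. \<exists>e\<in>E. a \<noteq> e \<and> (\<forall>Y\<in>V. a \<in> Y \<longleftrightarrow> e \<in> Y)) \<or>
      (\<exists>a b c. distinct [a, b, c] \<and> {a, b} \<in> V \<and> {a, c} \<in> V)" (is "?loop \<or> ?coloop \<or> ?series \<or> ?parallel")
    proof -
      have ?parallel if n: "\<not> ?loop" "\<not> ?coloop" "\<not> ?series"
      proof (rule exists_three_parallel[OF V False less.prems(3)])
        show "{e} \<notin> V" for e using n(1) by (rule contrapos_nn) (rule exI)
        show "\<exists>Y\<in>V. e \<in> Y" if "e \<in> E" for e using n(2) that by auto
        show "\<exists>Y\<in>V. (e \<in> Y) \<noteq> (e' \<in> Y)" if "e \<in> E" "e' \<in> E" "e \<noteq> e'" for e e'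
          using n(3) that by metis
      qed
      then show ?thesis by argo
    qed
    then consider (loop) e where "{e} \<in> V"
      | (coloop) e where "e \<in> E" "\<And>Y. Y \<in> V \<Longrightarrow> e \<notin> Y"
      | (series) a e where "a \<in> E" "e \<in> E" "a \<noteq> e" "\<And>Y. Y \<in> V \<Longrightarrow> a \<in> Y \<longleftrightarrow> e \<in> Y"
      | (parallel) a b c where "distinct [a, b, c]" "{a, b} \<in> V" "{a, c} \<in> V"
      by (elim disjE exE bexE conjE) metis+
    then show ?thesis
    proof cases
      case loop
      have e: "e \<in> E" using VD(2)[OF loop] by simp
      have qe: "q \<noteq> e" using e q by auto
      show ?thesis
      proof (cases "e \<in> X")
        case True
        \<comment> \<open>A loop in \<open>X\<close> becomes parallel to \<open>q\<close>, since its
          cycle has odd intersection with \<open>X\<close>.\<close>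
        have "{q, e} - {q} = {e}" "{q, e} \<inter> X - {q} = {e}" using True qe by auto
        then have "{q, e} \<in> ?W" using loop by (simp add: split_space_def)
        then show ?thesis
          using gammoid_indep_cycle_free_parallel[OF W, of e q] e qe del[OF e] by simp
      next
        case False
        have "{e} - {q} = {e}" "{e} \<inter> X - {q} = {}" using False qe by auto
        then have "{e} \<in> ?W" using loop qe by (simp add: split_space_def)
        then show ?thesis
          using gammoid_indep_cycle_free_loop[of e "insert q E" ?W] e del[OF e] by simp
      qed
    next
      case coloop
      have "e \<notin> Y" if "Y \<in> ?W" for Y
        using coloop(2)[OF split_spaceD(1)[OF that]] coloop(1) q by blast
      then show ?thesis
        using gammoid_indep_cycle_free_coloop[of e "insert q E" ?W] coloop(1) del by simp
    next
      case series
      let ?V' = "(\<lambda>Y. Y - {e}) ` V"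
      have "gammoid_indep (insert q (E - {e}))
          (cycle_free (split_space ?V' (if e \<in> X then sym_diff X {a} else X) q))"
      proof (rule less.hyps)
        show "card (E - {e}) < card E" using series(2) VD(1) by (rule card_Diff1_less[rotated])
        show "bin_space (E - {e}) ?V'" using V by (rule bin_space_contract)
        show "\<not> G7_config (E - {e}) ?V'"
          using less.prems(3) by (rule contrapos_nn) (rule G7_config_contract_series[OF series(4,3,2)])
      qed (use q in auto)
      moreover have "insert q (E - {e}) = insert q E - {e}" using series(2) q by auto
      moreover have "(\<lambda>Y. Y - {e}) ` ?W = split_space ?V' (if e \<in> X then sym_diff X {a} else X) q"
        using split_space_contract_series[OF V q series(4,1,2,3)] .
      ultimately have g: "gammoid_indep (insert q E - {e}) (cycle_free ((\<lambda>Y. Y - {e}) ` ?W))"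
        by simp
      have "a \<in> Y \<longleftrightarrow> e \<in> Y" if "Y \<in> ?W" for Y
      proof -
        from series(4)[OF split_spaceD(1)[OF that]] show ?thesis using series(1,2) q by blast
      qed
      then show ?thesis
        using gammoid_indep_cycle_free_series[of e "insert q E" a ?W, OF _ _ series(3) _ g] series(1,2) by simp
    next
      case parallel
      have "sym_diff {a, b} {a, c} = {b, c}" using parallel(1) by auto
      then have bc: "{b, c} \<in> V" using VD(4)[OF parallel(2,3)] by simp
      \<comment> \<open>Agreement on \<open>X\<close> makes the parity of the pair even, so it stays
        a cycle of the splitting.\<close>
      obtain u v where uv: "u \<noteq> v" "{u, v} \<in> V" "u \<in> X \<longleftrightarrow> v \<in> X"
        using parallel bc by (cases "a \<in> X"; cases "b \<in> X"; cases "c \<in> X") (auto intro: that)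
      have E: "u \<in> E" "v \<in> E" using VD(2)[OF uv(2)] by auto
      have "{u, v} - {q} = {u, v}" "q \<notin> {u, v}" "even (card ({u, v} \<inter> X - {q}))"
      proof -
        show "{u, v} - {q} = {u, v}" "q \<notin> {u, v}" using E q by auto
        have "{u, v} \<inter> X - {q} = (if u \<in> X then {u, v} else {})" using E q uv(3) by auto
        then show "even (card ({u, v} \<inter> X - {q}))" using uv(1) by simp
      qed
      then have "{u, v} \<in> ?W" using uv(2) unfolding split_space_def by simp
      then show ?thesis
        using gammoid_indep_cycle_free_parallel[OF W, of v u] E uv(1) del[OF E(2)] by simp
    qed
  qed
qed

section \<open>Splitting a matroid with a \<open>G7\<close> minor\<close>

text \<open>The cycle space of \<open>G7\<close>: the eight sums of \<open>{e0, e1}\<close>,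
  \<open>{e2, e3}\<close> and \<open>{e0, e2, e4}\<close>.\<close>

definition G7_traces :: "'a \<Rightarrow> 'a \<Rightarrow> 'a \<Rightarrow> 'a \<Rightarrow> 'a \<Rightarrow> 'a set set" where
  "G7_traces e0 e1 e2 e3 e4 =
     {{}, {e0, e1}, {e2, e3}, {e0, e1, e2, e3}, {e0, e2, e4}, {e1, e2, e4}, {e0, e3, e4}, {e1, e3, e4}}"

text \<open>Sums of \<open>Y1\<close>, \<open>Y2\<close>, \<open>Y3\<close> realize all eight
  patterns on \<open>e1\<close>, \<open>e3\<close>, \<open>e4\<close>. Two cycles with the same
  pattern differ by a cycle inside \<open>C \<union> {e0, e2}\<close>, which is empty.\<close>

lemma G7_config_traces:
  assumes V: "bin_space E V" and d: "distinct [e0, e1, e2, e3, e4]"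
    and C: "{e0, e1, e2, e3, e4} \<inter> C = {}" and cf: "cycle_free V (C \<union> {e0, e2})"
    and Y: "Y1 \<in> V" "Y2 \<in> V" "Y3 \<in> V"
    and t: "Y1 - C = {e0, e1}" "Y2 - C = {e2, e3}" "Y3 - C = {e0, e2, e4}"
  shows "{Y - C |Y. Y \<in> V \<and> Y \<subseteq> C \<union> {e0, e1, e2, e3, e4}} = G7_traces e0 e1 e2 e3 e4"
proof -
  note add = bin_spaceD(4)[OF V]
  have sd: "sym_diff Y Z - C = sym_diff (Y - C) (Z - C)" for Y Z by blast
  have t12: "sym_diff Y1 Y2 - C = {e0, e1, e2, e3}" unfolding sd t using d by auto
  have t13: "sym_diff Y1 Y3 - C = {e1, e2, e4}" unfolding sd t using d by auto
  have t23: "sym_diff Y2 Y3 - C = {e0, e3, e4}" unfolding sd t using d by auto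
  have t123: "sym_diff Y1 (sym_diff Y2 Y3) - C = {e1, e3, e4}" unfolding sd t using d by auto
  have mem: "\<exists>Z. Z \<in> V \<and> Z - C \<in> G7_traces e0 e1 e2 e3 e4 \<and> Z \<subseteq> C \<union> {e0, e1, e2, e3, e4} \<and>
      (e1 \<in> Z \<longleftrightarrow> p1) \<and> (e3 \<in> Z \<longleftrightarrow> p3) \<and> (e4 \<in> Z \<longleftrightarrow> p4)" for p1 p3 p4
  proof -
    have ex: ?thesis if Z: "Z \<in> V" "Z - C = T" "T \<in> G7_traces e0 e1 e2 e3 e4" "T \<subseteq> {e0, e1, e2, e3, e4}"
      "e1 \<in> T \<longleftrightarrow> p1" "e3 \<in> T \<longleftrightarrow> p3" "e4 \<in> T \<longleftrightarrow> p4" for Z T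
    proof (intro exI[of _ Z] conjI)
      have "e1 \<notin> C" "e3 \<notin> C" "e4 \<notin> C" using C by auto
      then show "e1 \<in> Z \<longleftrightarrow> p1" "e3 \<in> Z \<longleftrightarrow> p3" "e4 \<in> Z \<longleftrightarrow> p4" using Z(2,5-7) by auto
      show "Z \<subseteq> C \<union> {e0, e1, e2, e3, e4}" using Z(2,4) by blast
    qed (use Z in auto)
    have n: "e1 \<noteq> e0" "e1 \<noteq> e2" "e1 \<noteq> e3" "e1 \<noteq> e4" "e3 \<noteq> e0" "e3 \<noteq> e1" "e3 \<noteq> e2" "e3 \<noteq> e4"
      "e4 \<noteq> e0" "e4 \<noteq> e1" "e4 \<noteq> e2" "e4 \<noteq> e3" using d by auto
    note tr = G7_traces_def
    show ?thesis
      using ex[OF bin_spaceD(3)[OF V] empty_Diff] ex[OF Y(1) t(1)] ex[OF Y(2) t(2)] ex[OF Y(3) t(3)]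
        ex[OF add[OF Y(1,2)] t12] ex[OF add[OF Y(1,3)] t13] ex[OF add[OF Y(2,3)] t23]
        ex[OF add[OF Y(1) add[OF Y(2,3)]] t123] n
      by (cases p1; cases p3; cases p4) (simp_all add: tr)
  qed
  show ?thesis
  proof (intro equalityI subsetI)
    fix T assume "T \<in> {Y - C |Y. Y \<in> V \<and> Y \<subseteq> C \<union> {e0, e1, e2, e3, e4}}"
    then obtain Y where T: "T = Y - C" and YV: "Y \<in> V" "Y \<subseteq> C \<union> {e0, e1, e2, e3, e4}" by blast
    obtain Z where Z: "Z \<in> V" "Z - C \<in> G7_traces e0 e1 e2 e3 e4" "Z \<subseteq> C \<union> {e0, e1, e2, e3, e4}"
      "e1 \<in> Z \<longleftrightarrow> e1 \<in> Y" "e3 \<in> Z \<longleftrightarrow> e3 \<in> Y" "e4 \<in> Z \<longleftrightarrow> e4 \<in> Y" using mem by metis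
    have "sym_diff Y Z \<subseteq> C \<union> {e0, e2}" using YV(2) Z(3-6) by blast
    then have "sym_diff Y Z = {}" by (rule cycle_freeD[OF cf add[OF YV(1) Z(1)]])
    then have "Y = Z" by blast
    then show "T \<in> G7_traces e0 e1 e2 e3 e4" using T Z(2) by simp
  next
    fix T assume "T \<in> G7_traces e0 e1 e2 e3 e4"
    then have "\<exists>Y\<in>V. Y - C = T"
      using bin_spaceD(3)[OF V] Y t add[OF Y(1,2)] t12 add[OF Y(1,3)] t13 add[OF Y(2,3)] t23
        add[OF Y(1) add[OF Y(2,3)]] t123
      unfolding G7_traces_def by (elim insertE emptyE) (simp, blast+)
    then obtain Y where "Y \<in> V" "Y - C = T" by blast
    moreover have "T \<subseteq> {e0, e1, e2, e3, e4}"
      using \<open>T \<in> G7_traces e0 e1 e2 e3 e4\<close> unfolding G7_traces_def by auto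
    ultimately show "T \<in> {Y - C |Y. Y \<in> V \<and> Y \<subseteq> C \<union> {e0, e1, e2, e3, e4}}" by blast
  qed
qed

text \<open>This is independence after contracting \<open>C\<close>: a cycle with empty trace lies
  in \<open>C\<close> and is therefore empty, so passing to traces loses nothing.\<close>

lemma cycle_free_iff_traces:
  assumes "cycle_free V C" "I \<subseteq> Q"
  shows "cycle_free V (C \<union> I) \<longleftrightarrow> (\<forall>T\<in>{Y - C |Y. Y \<in> V \<and> Y \<subseteq> C \<union> Q}. T \<subseteq> I \<longrightarrow> T = {})"
proof
  assume L: "cycle_free V (C \<union> I)"
  have "Y = {}" if "Y \<in> V" "Y - C \<subseteq> I" for Y
    by (rule cycle_freeD[OF L that(1)]) (use that(2) in blast)
  then show "\<forall>T\<in>{Y - C |Y. Y \<in> V \<and> Y \<subseteq> C \<union> Q}. T \<subseteq> I \<longrightarrow> T = {}" by blast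
next
  assume R: "\<forall>T\<in>{Y - C |Y. Y \<in> V \<and> Y \<subseteq> C \<union> Q}. T \<subseteq> I \<longrightarrow> T = {}"
  show "cycle_free V (C \<union> I)" unfolding cycle_free_def
  proof (intro ballI impI)
    fix Y assume Y: "Y \<in> V" "Y \<subseteq> C \<union> I"
    have "Y - C \<in> {Y - C |Y. Y \<in> V \<and> Y \<subseteq> C \<union> Q}" "Y - C \<subseteq> I" using Y assms(2) by blast+
    from bspec[OF R this(1)] this(2) have "Y - C = {}" by (rule mp)
    then have "Y \<subseteq> C" by blast
    then show "Y = {}" by (rule cycle_freeD[OF assms(1) Y(1)])
  qed
qed

text \<open>\<open>X\<close> avoids \<open>C\<close>, so the parity of a cycle can be read off its
  trace: splitting commutes with contracting \<open>C\<close>.\<close>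

lemma split_space_traces:
  assumes "q \<notin> C" "q \<notin> Q" "X \<subseteq> Q" "X \<inter> C = {}" and V: "\<And>Y. Y \<in> V \<Longrightarrow> q \<notin> Y"
  shows "{Y - C |Y. Y \<in> split_space V X q \<and> Y \<subseteq> C \<union> insert q Q} =
    (\<lambda>T. if odd (card (T \<inter> X)) then insert q T else T) ` {Y - C |Y. Y \<in> V \<and> Y \<subseteq> C \<union> Q}"
proof -
  have qX: "q \<notin> X" using assms(2,3) by blast
  show ?thesis
  proof (intro equalityI subsetI)
    fix T assume "T \<in> {Y - C |Y. Y \<in> split_space V X q \<and> Y \<subseteq> C \<union> insert q Q}"
    then obtain Y where T: "T = Y - C" and Y: "Y \<in> split_space V X q" "Y \<subseteq> C \<union> insert q Q" by blast
    have "Y \<inter> X - {q} = (Y - {q} - C) \<inter> X" using qX assms(4) by blast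
    then have "q \<in> Y \<longleftrightarrow> odd (card ((Y - {q} - C) \<inter> X))" using split_spaceD(2)[OF Y(1)] by metis
    then have "T = (if odd (card ((Y - {q} - C) \<inter> X)) then insert q (Y - {q} - C) else Y - {q} - C)"
      using T assms(1) by (cases "q \<in> Y") auto
    moreover have "Y - {q} \<in> V" "Y - {q} \<subseteq> C \<union> Q" using split_spaceD(1)[OF Y(1)] Y(2) by blast+
    ultimately show "T \<in> (\<lambda>T. if odd (card (T \<inter> X)) then insert q T else T) ` {Y - C |Y. Y \<in> V \<and> Y \<subseteq> C \<union> Q}"
      by blast
  next
    fix T assume "T \<in> (\<lambda>T. if odd (card (T \<inter> X)) then insert q T else T) ` {Y - C |Y. Y \<in> V \<and> Y \<subseteq> C \<union> Q}"
    then obtain Y where T: "T = (if odd (card ((Y - C) \<inter> X)) then insert q (Y - C) else Y - C)"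
      and Y: "Y \<in> V" "Y \<subseteq> C \<union> Q" by blast
    define U where "U = (if odd (card ((Y - C) \<inter> X)) then insert q Y else Y)"
    have qY: "q \<notin> Y" using V[OF Y(1)] .
    have UY: "U - {q} = Y" using qY by (auto simp: U_def)
    have "U \<inter> X - {q} = (Y - C) \<inter> X" using UY qX assms(4) by blast
    moreover have "q \<in> U \<longleftrightarrow> odd (card ((Y - C) \<inter> X))" using qY by (simp add: U_def)
    ultimately have "q \<in> U \<longleftrightarrow> odd (card (U \<inter> X - {q}))" by metis
    then have "U \<in> split_space V X q" using UY Y(1) by (intro split_spaceI) (simp_all only:)
    moreover have "U \<subseteq> C \<union> insert q Q" using Y(2) by (auto simp: U_def)
    moreover have "T = U - C" using T assms(1) by (auto simp: U_def)
    ultimately show "T \<in> {Y - C |Y. Y \<in> split_space V X q \<and> Y \<subseteq> C \<union> insert q Q}" by blast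
  qed
qed

text \<open>Splitting on \<open>{e0, e2}\<close> turns \<open>G7\<close> into \<open>K4\<close>, which is not base-orderable: an exchange between the
  complementary paths \<open>{q, e1, e4}\<close> and \<open>{e0, e2, e3}\<close> would have to send both ends of the first
  path to \<open>e2\<close>.\<close>

lemma G7_config_not_gammoid:
  assumes V: "bin_space E V" and q: "q \<notin> E" and "G7_config E V"
  shows "\<exists>X\<subseteq>E. card X = 2 \<and> \<not> gammoid_indep (insert q E) (cycle_free (split_space V X q))"
  using assms(3)
proof (rule G7_configE)
  fix C e0 e1 e2 e3 e4 Y1 Y2 Y3
  assume C: "C \<subseteq> E" and d: "distinct [e0, e1, e2, e3, e4]" and ec: "{e0, e1, e2, e3, e4} \<inter> C = {}"
    and cf: "cycle_free V (C \<union> {e0, e2})" and Y: "Y1 \<in> V" "Y2 \<in> V" "Y3 \<in> V"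
    and t: "Y1 - C = {e0, e1}" "Y2 - C = {e2, e3}" "Y3 - C = {e0, e2, e4}"
  let ?Q = "{e0, e1, e2, e3, e4}"
  let ?X = "{e0, e2}"
  let ?W = "split_space V ?X q"
  \<comment> \<open>The cycle space of K4: the empty set, four triangles and three cycles of length
    four. The traces that contain exactly one of \<open>e0\<close> and \<open>e2\<close> have
    received \<open>q\<close>.\<close>
  let ?T = "{{}, {e0, e1, e2, e3}, {e0, e2, e4}, {e1, e3, e4}, {q, e0, e1}, {q, e2, e3}, {q, e1, e2, e4},
      {q, e0, e3, e4}}"
  note VD = bin_spaceD[OF V]
  have "{e0, e1} \<subseteq> E" "{e2, e3} \<subseteq> E" "{e0, e2, e4} \<subseteq> E"
    unfolding t[symmetric] using VD(2) Y by blast+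
  then have QE: "?Q \<subseteq> E" by simp
  have qY: "q \<notin> Y" if "Y \<in> V" for Y using VD(2)[OF that] q by blast
  have qn: "q \<notin> ?Q" "q \<notin> C" using QE C q by blast+
  have "cycle_free ?W C" unfolding cycle_free_def
  proof (intro ballI impI)
    fix Y assume YW: "Y \<in> ?W" "Y \<subseteq> C"
    then have "Y - {q} = Y" using qn by blast
    then have "Y \<in> V" using split_spaceD(1)[OF YW(1)] by simp
    then show "Y = {}" by (rule cycle_freeD[OF cf]) (use YW(2) in blast)
  qed
  note free = cycle_free_iff_traces[OF this, of _ "insert q ?Q"]
  have "{Y - C |Y. Y \<in> ?W \<and> Y \<subseteq> C \<union> insert q ?Q} =
      (\<lambda>T. if odd (card (T \<inter> ?X)) then insert q T else T) ` G7_traces e0 e1 e2 e3 e4"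
    unfolding G7_config_traces[OF V d ec cf Y t, symmetric]
    by (rule split_space_traces) (use qn ec qY in auto)
  also have "\<dots> = ?T" using d unfolding G7_traces_def by simp
  finally have tr: "{Y - C |Y. Y \<in> ?W \<and> Y \<subseteq> C \<union> insert q ?Q} = ?T" .
  have ind: "cycle_free ?W (C \<union> I)" if "I \<subseteq> insert q ?Q"
    "\<not> {q, e0, e1} \<subseteq> I" "\<not> {q, e2, e3} \<subseteq> I" "\<not> {e0, e1, e2, e3} \<subseteq> I" "\<not> {e0, e2, e4} \<subseteq> I"
    "\<not> {q, e1, e2, e4} \<subseteq> I" "\<not> {q, e0, e3, e4} \<subseteq> I" "\<not> {e1, e3, e4} \<subseteq> I" for I
    unfolding free[OF that(1)] tr using that by (simp del: insert_subset)
  have dep: "\<not> cycle_free ?W J" if "C \<union> T \<subseteq> J" "T \<noteq> {}"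
    "T \<in> ?T" for J T
  proof
    assume "cycle_free ?W J"
    then have L: "cycle_free ?W (C \<union> T)" using that(1) by (rule cycle_free_mono)
    have "T \<subseteq> insert q ?Q" using that(3) by auto
    from bspec[OF L[unfolded free[OF this] tr] that(3)] show False using that(2) by simp
  qed
  \<comment> \<open>Both sets contain \<open>C\<close>, so the exchange fixes \<open>C\<close>
    pointwise and, being injective, sends the remaining elements of \<open>B1\<close> to
    \<open>{e0, e2, e3}\<close>.\<close>
  define B1 where "B1 = C \<union> {q, e1, e4}"
  define B2 where "B2 = C \<union> {e0, e2, e3}"
  have n: "e0 \<noteq> e1" "e0 \<noteq> e2" "e0 \<noteq> e3" "e0 \<noteq> e4" "e1 \<noteq> e2" "e1 \<noteq> e3" "e1 \<noteq> e4" "e2 \<noteq> e3" "e2 \<noteq> e4" "e3 \<noteq> e4"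
    "q \<noteq> e0" "q \<noteq> e1" "q \<noteq> e2" "q \<noteq> e3" "q \<noteq> e4"
    "e0 \<notin> C" "e1 \<notin> C" "e2 \<notin> C" "e3 \<notin> C" "e4 \<notin> C" using d qn ec by auto
  have "\<not> gammoid_indep (insert q E) (cycle_free ?W)"
  proof
    assume g: "gammoid_indep (insert q E) (cycle_free ?W)"
    have "B1 \<subseteq> insert q E" "B2 \<subseteq> insert q E" using C QE by (auto simp: B1_def B2_def)
    moreover have "cycle_free ?W B1" unfolding B1_def by (rule ind) (use n in auto)
    moreover have "cycle_free ?W B2" unfolding B2_def by (rule ind) (use n in auto)
    moreover have "\<not> cycle_free ?W (insert x B2)" if "x \<in> B1 - B2" for x
    proof -
      have "x = q \<or> x = e1 \<or> x = e4" using that by (auto simp: B1_def B2_def)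
      moreover have "\<not> cycle_free ?W (insert q B2)" by (rule dep[of "{q, e2, e3}"]) (auto simp: B2_def)
      moreover have "\<not> cycle_free ?W (insert e1 B2)" by (rule dep[of "{e0, e1, e2, e3}"]) (auto simp: B2_def)
      moreover have "\<not> cycle_free ?W (insert e4 B2)" by (rule dep[of "{e0, e2, e4}"]) (auto simp: B2_def)
      ultimately show ?thesis by blast
    qed
    ultimately obtain f where f: "inj_on f B1" "f ` B1 \<subseteq> B2" "\<forall>x\<in>B1 \<inter> B2. f x = x"
      "\<forall>x\<in>B1. cycle_free ?W (insert (f x) (B1 - {x})) \<and> cycle_free ?W (insert x (B2 - {f x}))"
      using gammoid_indep_base_orderable[OF g] by metis
    have fx: "f x \<in> {e0, e2, e3}" if x: "x \<in> {q, e1, e4}" for x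
    proof -
      have "f x \<notin> C"
      proof
        assume fC: "f x \<in> C"
        then have "f (f x) = f x" using f(3) by (simp add: B1_def B2_def)
        moreover have "f x \<in> B1" "x \<in> B1" using fC x by (auto simp: B1_def)
        ultimately have "f x = x" using f(1) by (auto dest: inj_onD)
        then show False using fC x n qn by auto
      qed
      moreover have "f x \<in> B2" using f(2) x by (auto simp: B1_def)
      ultimately show ?thesis by (simp add: B2_def)
    qed
    have qB: "q \<in> B1" "e4 \<in> B1" by (auto simp: B1_def)
    have fq: "cycle_free ?W (insert (f q) (B1 - {q}))" "cycle_free ?W (insert q (B2 - {f q}))"
      and f4: "cycle_free ?W (insert (f e4) (B1 - {e4}))" "cycle_free ?W (insert e4 (B2 - {f e4}))"
      using f(4) qB by blast+
    \<comment> \<open>The alternatives to \<open>e2\<close> each create a triangle: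
      \<open>{e1, e3, e4}\<close> and \<open>{q, e2, e3}\<close> for \<open>f q\<close>,
      \<open>{q, e0, e1}\<close> and \<open>{e0, e2, e4}\<close> for \<open>f e4\<close>.\<close>
    have "f q \<noteq> e3"
    proof
      assume "f q = e3"
      then show False using fq(1) dep[of "{e1, e3, e4}" "insert e3 (B1 - {q})"] n qn by (auto simp: B1_def)
    qed
    moreover have "f q \<noteq> e0"
    proof
      assume "f q = e0"
      then show False using fq(2) dep[of "{q, e2, e3}" "insert q (B2 - {e0})"] n qn by (auto simp: B2_def)
    qed
    ultimately have "f q = e2" using fx[of q] by simp
    have "f e4 \<noteq> e0"
    proof
      assume "f e4 = e0"
      then show False using f4(1) dep[of "{q, e0, e1}" "insert e0 (B1 - {e4})"] n qn by (auto simp: B1_def)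
    qed
    moreover have "f e4 \<noteq> e3"
    proof
      assume "f e4 = e3"
      then show False using f4(2) dep[of "{e0, e2, e4}" "insert e4 (B2 - {e3})"] n qn by (auto simp: B2_def)
    qed
    ultimately have "f e4 = e2" using fx[of e4] by simp
    then have "q = e4" using f(1) qB \<open>f q = e2\<close> by (metis inj_onD)
    then show False using n by blast
  qed
  moreover have "?X \<subseteq> E" "card ?X = 2" using QE n by auto
  ultimately show ?thesis by blast
qed

section \<open>Minors isomorphic to \<open>M(G7)\<close>\<close>

lemma matroidD:
  assumes "matroid M"
  shows "finite (ground M)" "I \<in> indeps M \<Longrightarrow> I \<subseteq> ground M" "I \<in> indeps M \<Longrightarrow> J \<subseteq> I \<Longrightarrow> J \<in> indeps M"
    "I \<in> indeps M \<Longrightarrow> J \<in> indeps M \<Longrightarrow> card I < card J \<Longrightarrow> \<exists>x\<in>J - I. insert x I \<in> indeps M"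
    "I \<in> indeps M \<Longrightarrow> finite I"
proof -
  show "finite (ground M)" using assms unfolding matroid_def by (elim conjE)
  show "I \<in> indeps M \<Longrightarrow> J \<subseteq> I \<Longrightarrow> J \<in> indeps M"
    "I \<in> indeps M \<Longrightarrow> J \<in> indeps M \<Longrightarrow> card I < card J \<Longrightarrow> \<exists>x\<in>J - I. insert x I \<in> indeps M"
    "I \<in> indeps M \<Longrightarrow> I \<subseteq> ground M"
    using assms unfolding matroid_def by simp_all
  then show "I \<in> indeps M \<Longrightarrow> finite I" using \<open>finite (ground M)\<close> finite_subset by metis
qed

lemma card_basis_of_le:
  assumes M: "matroid M" and J: "basis_of M C J" "basis_of M C J'"
  shows "card J' \<le> card J"
proof (rule ccontr)
  assume "\<not> ?thesis"
  then obtain x where "x \<in> J' - J" "insert x J \<in> indeps M"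
    using matroidD(4)[OF M, of J J'] J unfolding basis_of_def by auto
  moreover from this have "J \<subseteq> insert x J" "insert x J \<subseteq> C" using J unfolding basis_of_def by auto
  ultimately have "insert x J = J" using J(1) unfolding basis_of_def by metis
  then show False using \<open>x \<in> J' - J\<close> by blast
qed

text \<open>Contraction asks for some basis of \<open>C\<close>; this makes any other basis equally
  good. \<open>J\<close> is extended to a maximal independent \<open>K\<close> inside
  \<open>I \<union> J\<close>. If \<open>K\<close> were smaller than \<open>I \<union> J'\<close>,
  augmentation would add an element of \<open>I\<close>, against the choice of \<open>K\<close>, or
  one of \<open>C\<close>, against the maximality of \<open>J\<close>.\<close>

lemma indep_Un_basis_of:
  assumes M: "matroid M" and J: "basis_of M C J" "basis_of M C J'" and I: "I \<inter> C = {}" "I \<union> J' \<in> indeps M"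
  shows "I \<union> J \<in> indeps M"
proof -
  let ?S = "{K. K \<in> indeps M \<and> J \<subseteq> K \<and> K \<subseteq> I \<union> J}"
  have J': "J \<in> indeps M" "J \<subseteq> C" "J' \<subseteq> C" using J by (auto simp: basis_of_def)
  have fin: "finite (I \<union> J')" "finite J" using matroidD(5)[OF M] I(2) J'(1) by blast+
  have finS: "finite ?S" using fin finite_subset[of ?S "Pow (I \<union> J)"] by auto
  have JS: "J \<in> ?S" using J' by auto
  obtain K where K: "K \<in> ?S" "\<forall>L\<in>?S. K \<subseteq> L \<longrightarrow> K = L"
    using finite_has_maximal2[OF finS JS] by (elim bexE conjE) (rule that)
  have "\<not> card K < card (I \<union> J')"
  proof
    assume "card K < card (I \<union> J')"
    then obtain x where x: "x \<in> (I \<union> J') - K" "insert x K \<in> indeps M"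
      using matroidD(4)[OF M, of K "I \<union> J'"] K(1) I(2) by auto
    show False
    proof (cases "x \<in> I")
      case True
      then have "insert x K \<in> ?S" using x K(1) by auto
      then have "K = insert x K" using K(2) by blast
      then show False using x by blast
    next
      case False
      then have xC: "x \<in> C" using x J'(3) by auto
      have "insert x J \<in> indeps M" using matroidD(3)[OF M x(2), of "insert x J"] K(1) by auto
      moreover have "J \<subseteq> insert x J" "insert x J \<subseteq> C" using xC J'(2) by auto
      ultimately have "insert x J = J" using J(1) unfolding basis_of_def by metis
      then show False using x(1) K(1) by auto
    qed
  qed
  moreover have "card (I \<union> J') = card I + card J'"
    using fin I(1) J' by (intro card_Un_disjoint) auto
  moreover have "card (I \<union> J) = card I + card J"
    using fin I(1) J' by (intro card_Un_disjoint) auto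
  moreover have "card J \<le> card J'" using card_basis_of_le[OF M J(2,1)] .
  ultimately have "card (I \<union> J) \<le> card K" by simp
  moreover have "K \<subseteq> I \<union> J" "finite (I \<union> J)" using K(1) fin by auto
  ultimately have "K = I \<union> J" by (metis card_seteq)
  then show ?thesis using K(1) by simp
qed

lemma indeps_minor:
  assumes "N = matroid_delete (matroid_contract M C) D"
  shows "ground N = ground M - C - D"
    and "I \<in> indeps N \<longleftrightarrow> I \<subseteq> ground N \<and> (\<exists>J. basis_of M C J \<and> I \<union> J \<in> indeps M)"
  unfolding assms matroid_delete_def matroid_contract_def by auto

section \<open>The circuits of \<open>G7\<close>\<close>

lemma is_cycleI:
  assumes "es \<noteq> []" "length vs = length es" "distinct vs" "distinct es" "set vs \<subseteq> mverts G"
    "set es \<subseteq> medges G" "C = set es"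
    "\<forall>i<length es. ends G (es ! i) = {vs ! i, vs ! (Suc i mod length es)}"
  shows "is_cycle G C"
  unfolding is_cycle_def by (rule exI[of _ vs], rule exI[of _ es]) (intro conjI assms)

definition G7_circuits :: "nat set set" where
  "G7_circuits = {{0, 1}, {2, 3}, {0, 2, 4}, {0, 3, 4}, {1, 2, 4}, {1, 3, 4}}"

lemma G7_verts_edges: "mverts G7 = {0, 1, 2}" "medges G7 = {0, 1, 2, 3, 4}"
  by (simp_all add: G7_def)

lemma ends_G7:
  assumes "e \<in> {0, 1, 2, 3, 4}"
  shows "ends G7 e = {u, v} \<longleftrightarrow> (e = 0 \<or> e = 1) \<and> (u = 0 \<and> v = 1 \<or> u = 1 \<and> v = 0) \<or>
    (e = 2 \<or> e = 3) \<and> (u = 0 \<and> v = 2 \<or> u = 2 \<and> v = 0) \<or>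
    e = 4 \<and> (u = 1 \<and> v = 2 \<or> u = 2 \<and> v = 1)"
  using assms unfolding insert_iff empty_iff by (elim disjE) (auto simp: G7_def doubleton_eq_iff)

lemma G7_circuitsI:
  assumes "x = 0 \<or> x = 1" "y = 2 \<or> y = 3"
  shows "{x, y, 4} \<in> G7_circuits"
  using assms unfolding G7_circuits_def by (elim disjE) simp_all

text \<open>The vertices of a cycle are distinct, so its length is at most three. No edge is a loop,
  length two forces a parallel pair, and length three forces one edge from each of the three
  parallel classes.\<close>

lemma is_cycle_G7_imp:
  assumes "is_cycle G7 C"
  shows "C \<in> G7_circuits"
proof -
  obtain vs es where *: "es \<noteq> []" "length vs = length es" "distinct vs" "distinct es"
    "set vs \<subseteq> {0, 1, 2}" "set es \<subseteq> {0, 1, 2, 3, 4}" "C = set es"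
    "\<forall>i<length es. ends G7 (es ! i) = {vs ! i, vs ! (Suc i mod length es)}"
  proof -
    show thesis using assms that unfolding is_cycle_def G7_verts_edges by (elim exE conjE) simp
  qed
  note ends = *(8)[rule_format]
  have "card (set vs) \<le> card {0, 1, 2 :: nat}" using *(5) by (intro card_mono) auto
  then have "length es \<le> 3" using distinct_card[OF *(3)] *(2) by simp
  moreover have "length es \<noteq> 0" using *(1) by simp
  ultimately consider "length es = 1" | "length es = 2" | "length es = 3" by linarith
  then show ?thesis
  proof cases
    case 1
    then obtain a u where e: "es = [a]" "vs = [u]" using *(2) by (auto simp: length_Suc_conv)
    have "a \<in> {0, 1, 2, 3, 4}" using *(6) e by simp
    moreover have "ends G7 a = {u, u}" using ends[of 0] e by simp
    ultimately show ?thesis unfolding ends_G7[OF \<open>a \<in> _\<close>] by auto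
  next
    case 2
    then obtain a b u v where e: "es = [a, b]" "vs = [u, v]" using *(2) by (auto simp: length_Suc_conv numeral_2_eq_2)
    have ab: "a \<in> {0, 1, 2, 3, 4}" "b \<in> {0, 1, 2, 3, 4}" "a \<noteq> b" using *(4,6) e by simp_all
    have "ends G7 a = {u, v}" "ends G7 b = {v, u}" using ends[of 0] ends[of 1] e by simp_all
    then have "a = 0 \<and> b = 1 \<or> a = 1 \<and> b = 0 \<or> a = 2 \<and> b = 3 \<or> a = 3 \<and> b = 2"
      unfolding ends_G7[OF ab(1)] ends_G7[OF ab(2)]
      by (elim disjE conjE) (use ab(3) in simp_all)
    then show ?thesis unfolding *(7) e G7_circuits_def by (elim disjE) (simp_all add: insert_commute)
  next
    case 3
    then obtain a b c u v w where e: "es = [a, b, c]" "vs = [u, v, w]"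
      using *(2) by (auto simp: length_Suc_conv numeral_3_eq_3)
    have abc: "a \<in> {0, 1, 2, 3, 4}" "b \<in> {0, 1, 2, 3, 4}" "c \<in> {0, 1, 2, 3, 4}" using *(6) e by simp_all
    have en: "ends G7 a = {u, v}" "ends G7 b = {v, w}" "ends G7 c = {w, u}"
      using ends[of 0] ends[of 1] ends[of 2] e by simp_all
    have d: "u \<noteq> v" "u \<noteq> w" "v \<noteq> w" using *(3) e by simp_all
    have "(u = 0 \<and> v = 1 \<and> w = 2) \<or> (u = 0 \<and> v = 2 \<and> w = 1) \<or> (u = 1 \<and> v = 0 \<and> w = 2) \<or>
        (u = 1 \<and> v = 2 \<and> w = 0) \<or> (u = 2 \<and> v = 0 \<and> w = 1) \<or> (u = 2 \<and> v = 1 \<and> w = 0)"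
      using *(5) d unfolding e by auto
    \<comment> \<open>The parallel classes are folded into \<open>P\<close> and \<open>Q\<close>, so
      that each order of the vertices yields a single case.\<close>
    moreover define P where "P z \<longleftrightarrow> z = 0 \<or> z = 1" for z :: nat
    moreover define Q where "Q z \<longleftrightarrow> z = 2 \<or> z = 3" for z :: nat
    ultimately have "P a \<and> Q b \<and> c = 4 \<or> P a \<and> Q c \<and> b = 4 \<or> P b \<and> Q a \<and> c = 4 \<or>
        P b \<and> Q c \<and> a = 4 \<or> P c \<and> Q a \<and> b = 4 \<or> P c \<and> Q b \<and> a = 4"
      using en unfolding ends_G7[OF abc(1)] ends_G7[OF abc(2)] ends_G7[OF abc(3)]
        P_def[symmetric] Q_def[symmetric]
      by (elim disjE[of "u = 0 \<and> v = 1 \<and> w = 2"] disjE[of "u = 0 \<and> v = 2 \<and> w = 1"]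
          disjE[of "u = 1 \<and> v = 0 \<and> w = 2"] disjE[of "u = 1 \<and> v = 2 \<and> w = 0"]
          disjE[of "u = 2 \<and> v = 0 \<and> w = 1"]) simp_all
    moreover have "{x, y, 4} \<in> G7_circuits" if "P x" "Q y" for x y
      using that unfolding P_def Q_def by (rule G7_circuitsI)
    note this[of a b] this[of a c] this[of b a] this[of b c] this[of c a] this[of c b]
    ultimately have "{a, b, c} \<in> G7_circuits" by (elim disjE conjE) (simp_all add: insert_commute)
    then show ?thesis unfolding *(7) e by simp
  qed
qed

lemma G7_circuits_is_cycle:
  assumes "C \<in> G7_circuits"
  shows "is_cycle G7 C"
proof -
  have two: "is_cycle G7 {a, b}"
    if "v \<in> {0, 1, 2}" "v \<noteq> 0" "a \<noteq> b" "a \<in> {0, 1, 2, 3, 4}" "b \<in> {0, 1, 2, 3, 4}"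
      "ends G7 a = {0, v}" "ends G7 b = {v, 0}" for a b v
    by (rule is_cycleI[of "[a, b]" "[0, v]"]) (use that in \<open>simp_all add: G7_verts_edges All_less_Suc\<close>)
  have three: "is_cycle G7 {a, b, 4}" if ab: "a = 0 \<or> a = 1" "b = 2 \<or> b = 3" for a b
  proof (rule is_cycleI[of "[a, 4, b]" "[0, 1, 2]"])
    have "ends G7 a = {0, 1}" "ends G7 4 = {1, 2}" "ends G7 b = {2, 0}"
      using ab by (subst ends_G7; fastforce)+
    then show "\<forall>i<length [a, 4, b]. ends G7 ([a, 4, b] ! i) =
        {[0, 1, 2] ! i, [0, 1, 2] ! (Suc i mod length [a, 4, b])}"
      by (simp add: All_less_Suc numeral_2_eq_2)
  qed (use ab in \<open>auto simp: G7_verts_edges\<close>)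
  have "is_cycle G7 {0, 1}" "is_cycle G7 {2, 3}"
    by (rule two[of 1]; simp add: ends_G7) (rule two[of 2]; simp add: ends_G7)
  then show ?thesis using assms three[of 0 2] three[of 0 3] three[of 1 2] three[of 1 3]
    unfolding G7_circuits_def by auto
qed

lemma is_cycle_G7_iff: "is_cycle G7 C \<longleftrightarrow> C \<in> G7_circuits"
  using is_cycle_G7_imp G7_circuits_is_cycle by blast

lemma indeps_cycle_matroid_G7:
  "I \<in> indeps (cycle_matroid G7) \<longleftrightarrow> I \<subseteq> {0, 1, 2, 3, 4} \<and> (\<forall>C\<in>G7_circuits. \<not> C \<subseteq> I)"
  unfolding cycle_matroid_def by (auto simp: is_cycle_G7_iff G7_verts_edges simp del: insert_subset)

lemma ground_cycle_matroid_G7: "ground (cycle_matroid G7) = {0, 1, 2, 3, 4}"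
  by (simp add: cycle_matroid_def G7_verts_edges)

text \<open>\<open>C\<close> is contracted and everything outside it and the five elements is
  deleted. Being independent, \<open>C\<close> is its own only basis, so independence in
  \<open>N\<close> can be tested with \<open>C\<close> itself.\<close>

lemma G7_config_imp_minor:
  assumes V: "bin_space (ground B) V" and B: "\<And>I. I \<in> indeps B \<longleftrightarrow> I \<subseteq> ground B \<and> cycle_free V I"
    and "G7_config (ground B) V"
  shows "has_minor_iso B (cycle_matroid G7)"
  using assms(3)
proof (rule G7_configE)
  fix C e0 e1 e2 e3 e4 Y1 Y2 Y3
  assume C: "C \<subseteq> ground B" and d: "distinct [e0, e1, e2, e3, e4]" and ec: "{e0, e1, e2, e3, e4} \<inter> C = {}"
    and cf: "cycle_free V (C \<union> {e0, e2})" and Y: "Y1 \<in> V" "Y2 \<in> V" "Y3 \<in> V"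
    and t: "Y1 - C = {e0, e1}" "Y2 - C = {e2, e3}" "Y3 - C = {e0, e2, e4}"
  let ?Q = "{e0, e1, e2, e3, e4}"
  have cC: "cycle_free V C" using cf by (rule cycle_free_mono) auto
  have "{e0, e1} \<subseteq> ground B" "{e2, e3} \<subseteq> ground B" "{e0, e2, e4} \<subseteq> ground B"
    unfolding t[symmetric] using bin_spaceD(2)[OF V] Y by blast+
  then have QE: "?Q \<subseteq> ground B" by simp
  define D where "D = ground B - C - ?Q"
  define N where "N = matroid_delete (matroid_contract B C) D"
  have gN: "ground N = ?Q" unfolding indeps_minor(1)[OF N_def] D_def using QE ec by blast
  have "basis_of B C J \<longleftrightarrow> J = C" for J
    unfolding basis_of_def B using C cC cycle_free_mono[OF cC] by blast
  then have iN: "I \<in> indeps N \<longleftrightarrow> cycle_free V (C \<union> I)" if "I \<subseteq> ?Q" for I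
    unfolding indeps_minor(2)[OF N_def] gN using that B C QE by (auto simp: Un_commute)
  define f where "f x = (if x = e0 then 0 else if x = e1 then 1 else if x = e2 then 2
      else if x = e3 then 3 else 4 :: nat)" for x
  have f: "f e0 = 0" "f e1 = 1" "f e2 = 2" "f e3 = 3" "f e4 = 4" using d by (auto simp: f_def)
  have bij: "bij_betw f ?Q {0, 1, 2, 3, 4}" unfolding bij_betw_def
  proof
    show "inj_on f ?Q" unfolding inj_on_def using f by auto
    show "f ` ?Q = {0, 1, 2, 3, 4}" using f by simp
  qed
  have "I \<in> indeps N \<longleftrightarrow> f ` I \<in> indeps (cycle_matroid G7)" if I: "I \<subseteq> ?Q" for I
  proof -
    have m: "f x \<in> f ` I \<longleftrightarrow> x \<in> I" if "x \<in> ?Q" for x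
      using bij I that by (meson bij_betw_imp_inj_on inj_on_image_mem_iff)
    have m': "0 \<in> f ` I \<longleftrightarrow> e0 \<in> I" "1 \<in> f ` I \<longleftrightarrow> e1 \<in> I" "2 \<in> f ` I \<longleftrightarrow> e2 \<in> I"
      "3 \<in> f ` I \<longleftrightarrow> e3 \<in> I" "4 \<in> f ` I \<longleftrightarrow> e4 \<in> I"
      using m[of e0] m[of e1] m[of e2] m[of e3] m[of e4] unfolding f by simp_all
    have "f ` I \<subseteq> {0, 1, 2, 3, 4}" using bij I by (metis bij_betw_imp_surj_on image_mono)
    \<comment> \<open>Nonempty traces correspond to the circuits of \<open>G7\<close>, apart from
      \<open>{e0, e1, e2, e3}\<close>, which contains the trace \<open>{e0, e1}\<close>.\<close>
    then have "f ` I \<in> indeps (cycle_matroid G7) \<longleftrightarrow>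
        (\<forall>T\<in>G7_traces e0 e1 e2 e3 e4. T \<subseteq> I \<longrightarrow> T = {})"
      unfolding indeps_cycle_matroid_G7 G7_circuits_def G7_traces_def
      by (simp add: m'[simplified]) argo
    also have "\<dots> \<longleftrightarrow> cycle_free V (C \<union> I)"
      unfolding cycle_free_iff_traces[OF cC I] G7_config_traces[OF V d ec cf Y t] ..
    finally show ?thesis using iN[OF I] by simp
  qed
  then have "matroid_iso N (cycle_matroid G7)"
    unfolding matroid_iso_def gN ground_cycle_matroid_G7 using bij by blast
  moreover have "is_minor N B"
    unfolding is_minor_def using C N_def by (intro exI[of _ C] exI[of _ D]) (auto simp: D_def)
  ultimately show ?thesis unfolding has_minor_iso_def by blast
qed

text \<open>The contracted set of a minor may be dependent, whereas a configuration needs a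
  cycle-free one; a basis \<open>J\<close> of it takes its place. Circuits of the minor then lift to
  cycles with that circuit as trace outside \<open>J\<close>.\<close>

lemma minor_imp_G7_config:
  assumes M: "matroid B" and V: "bin_space (ground B) V"
    and B: "\<And>I. I \<in> indeps B \<longleftrightarrow> I \<subseteq> ground B \<and> cycle_free V I"
    and "has_minor_iso B (cycle_matroid G7)"
  shows "G7_config (ground B) V"
proof -
  obtain C D where CD: "C \<subseteq> ground B" "D \<subseteq> ground B"
    and iso: "matroid_iso (matroid_delete (matroid_contract B C) D) (cycle_matroid G7)"
    using assms(4) unfolding has_minor_iso_def is_minor_def by blast
  define N where "N = matroid_delete (matroid_contract B C) D"
  obtain f where bij: "bij_betw f (ground N) {0, 1, 2, 3, 4}"
    and f: "\<And>I. I \<subseteq> ground N \<Longrightarrow> I \<in> indeps N \<longleftrightarrow> f ` I \<in> indeps (cycle_matroid G7)"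
    using iso unfolding matroid_iso_def ground_cycle_matroid_G7 N_def by blast
  have gN: "ground N \<subseteq> ground B" "ground N \<inter> C = {}" unfolding indeps_minor(1)[OF N_def] by auto
  have "\<exists>e. e \<in> ground N \<and> f e = i" if "i \<in> {0, 1, 2, 3, 4}" for i
    using bij that unfolding bij_betw_def by (metis imageE)
  then obtain g where g: "\<And>i. i \<in> {0, 1, 2, 3, 4} \<Longrightarrow> g i \<in> ground N \<and> f (g i) = i" by metis
  define e0 e1 e2 e3 e4 where "e0 = g 0" and "e1 = g 1" and "e2 = g 2" and "e3 = g 3" and "e4 = g 4"
  note edef = e0_def e1_def e2_def e3_def e4_def
  have fe: "f e0 = 0" "f e1 = 1" "f e2 = 2" "f e3 = 3" "f e4 = 4"
    and eN: "e0 \<in> ground N" "e1 \<in> ground N" "e2 \<in> ground N" "e3 \<in> ground N" "e4 \<in> ground N"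
    unfolding edef using g by simp_all
  have d: "distinct [e0, e1, e2, e3, e4]" using fe by auto
  have "{e0, e2} \<in> indeps N"
    using f[of "{e0, e2}"] eN fe by (simp add: indeps_cycle_matroid_G7 G7_circuits_def)
  then obtain J where J: "basis_of B C J" "{e0, e2} \<union> J \<in> indeps B"
    unfolding indeps_minor(2)[OF N_def] by blast
  have JC: "J \<subseteq> C" using J(1) by (simp add: basis_of_def)
  \<comment> \<open>By \<open>indep_Un_basis_of\<close> the one basis \<open>J\<close> serves every
    \<open>I\<close>.\<close>
  have indN: "I \<in> indeps N \<longleftrightarrow> cycle_free V (I \<union> J)" if I: "I \<subseteq> ground N" for I
  proof -
    have "I \<inter> C = {}" using I gN by blast
    then have "I \<in> indeps N \<longleftrightarrow> I \<union> J \<in> indeps B"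
      unfolding indeps_minor(2)[OF N_def] using I J(1) indep_Un_basis_of[OF M J(1)] by blast
    moreover have "I \<union> J \<subseteq> ground B" using I gN JC CD by blast
    ultimately show ?thesis using B by blast
  qed
  have circ: "\<exists>Y\<in>V. Y - J = T"
    if T: "T \<subseteq> ground N" "T \<notin> indeps N" "\<And>x. x \<in> T \<Longrightarrow> T - {x} \<in> indeps N" for T
  proof -
    \<comment> \<open>A nonempty cycle inside \<open>T \<union> J\<close> must use every
      \<open>x\<close> in \<open>T\<close>, because \<open>T - {x}\<close> together with
      \<open>J\<close> is cycle-free.\<close>
    obtain Y where Y: "Y \<in> V" "Y \<subseteq> T \<union> J" "Y \<noteq> {}" using T(2) indN[OF T(1)] unfolding cycle_free_def by blast
    have "x \<in> Y" if x: "x \<in> T" for x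
    proof (rule ccontr)
      assume "x \<notin> Y"
      moreover have "cycle_free V (T - {x} \<union> J)" using indN[of "T - {x}"] T(1) T(3)[OF x] by blast
      ultimately show False using cycle_freeD[of V "T - {x} \<union> J" Y] Y by blast
    qed
    moreover have "T \<inter> J = {}" using T(1) gN JC by blast
    ultimately have "Y - J = T" using Y(2) by blast
    then show ?thesis using Y(1) by blast
  qed
  have sub: "{x, y} - {x} = {y}" "{x, y} - {y} = {x}" if "x \<noteq> y" for x y :: 'a using that by auto
  have n: "e0 \<noteq> e1" "e2 \<noteq> e3" "e0 \<noteq> e2" "e0 \<noteq> e4" "e2 \<noteq> e4" using d by auto
  have in7: "I \<in> indeps N" if "I \<in> {{e0}, {e1}, {e2}, {e3}, {e0, e2}, {e0, e4}, {e2, e4}}" for I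
  proof -
    have "I \<subseteq> ground N" using that eN by auto
    from f[OF this] show ?thesis using that unfolding insert_iff empty_iff
      by (elim disjE FalseE) (simp_all add: fe indeps_cycle_matroid_G7 G7_circuits_def)
  qed
  have i: "{e0} \<in> indeps N" "{e1} \<in> indeps N" "{e2} \<in> indeps N" "{e3} \<in> indeps N"
    "{e0, e2} \<in> indeps N" "{e0, e4} \<in> indeps N" "{e2, e4} \<in> indeps N"
    by (rule in7, simp)+
  have "\<exists>Y\<in>V. Y - J = {e0, e1}"
  proof (rule circ)
    show "{e0, e1} \<subseteq> ground N" using eN by simp
    then show "{e0, e1} \<notin> indeps N"
      using f[of "{e0, e1}"] fe by (simp add: indeps_cycle_matroid_G7 G7_circuits_def)
    show "{e0, e1} - {x} \<in> indeps N" if "x \<in> {e0, e1}" for x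
      using that i(1,2) sub[OF n(1)] by (metis insertE singletonD)
  qed
  then obtain Y1 where Y1: "Y1 \<in> V" "Y1 - J = {e0, e1}" by blast
  have "\<exists>Y\<in>V. Y - J = {e2, e3}"
  proof (rule circ)
    show "{e2, e3} \<subseteq> ground N" using eN by simp
    then show "{e2, e3} \<notin> indeps N"
      using f[of "{e2, e3}"] fe by (simp add: indeps_cycle_matroid_G7 G7_circuits_def)
    show "{e2, e3} - {x} \<in> indeps N" if "x \<in> {e2, e3}" for x
      using that i(3,4) sub[OF n(2)] by (metis insertE singletonD)
  qed
  then obtain Y2 where Y2: "Y2 \<in> V" "Y2 - J = {e2, e3}" by blast
  have "\<exists>Y\<in>V. Y - J = {e0, e2, e4}"
  proof (rule circ)
    show "{e0, e2, e4} \<subseteq> ground N" using eN by simp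
    then show "{e0, e2, e4} \<notin> indeps N"
      using f[of "{e0, e2, e4}"] fe by (simp add: indeps_cycle_matroid_G7 G7_circuits_def)
    have "{e0, e2, e4} - {e0} = {e2, e4}" "{e0, e2, e4} - {e2} = {e0, e4}" "{e0, e2, e4} - {e4} = {e0, e2}"
      using n by auto
    then show "{e0, e2, e4} - {x} \<in> indeps N" if "x \<in> {e0, e2, e4}" for x
      using that i(5-7) by (metis insertE singletonD)
  qed
  then obtain Y3 where Y3: "Y3 \<in> V" "Y3 - J = {e0, e2, e4}" by blast
  show ?thesis
  proof (rule G7_configI[OF _ d _ _ Y1(1) Y2(1) Y3(1) Y1(2) Y2(2) Y3(2)])
    show "J \<subseteq> ground B" using JC CD by blast
    show "{e0, e1, e2, e3, e4} \<inter> J = {}" using eN gN JC by blast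
    show "cycle_free V (J \<union> {e0, e2})" using J(2) B by (simp add: Un_commute)
  qed
qed

theorem theorem4p1:
  fixes B :: "'a indep_sys" and m :: nat and A :: "nat \<Rightarrow> 'a \<Rightarrow> bit" and q :: 'a
  assumes "graphic B"
    and "represents m A B"
    and "q \<notin> ground B"
  shows "(\<forall>X. X \<subseteq> ground B \<and> 2 \<le> card X \<longrightarrow> binary_gammoid (element_splitting m A B X q))
         \<longleftrightarrow> \<not> has_minor_iso B (cycle_matroid G7)"
proof -
  define V where "V = cycle_space m A (ground B)"
  have M: "matroid B" using assms(1) by (simp add: graphic_def)
  have fin: "finite (ground B)" using matroidD(1)[OF M] .
  have V: "bin_space (ground B) V" unfolding V_def using fin by (rule bin_space_cycle_space)
  have "B = vector_matroid m A (ground B)" using assms(2) by (simp add: represents_def)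
  then have B: "I \<in> indeps B \<longleftrightarrow> I \<subseteq> ground B \<and> cycle_free V I" for I
    unfolding V_def using indeps_vector_matroid[OF fin, of I m A] by metis
  have G7: "has_minor_iso B (cycle_matroid G7) \<longleftrightarrow> G7_config (ground B) V"
    using G7_config_imp_minor[OF V B] minor_imp_G7_config[OF M V B] by blast
  \<comment> \<open>The splitting is represented by its own matrix, so it is binary by construction
    and only the gammoid property remains.\<close>
  have bg: "binary_gammoid (element_splitting m A B X q) \<longleftrightarrow>
      gammoid_indep (insert q (ground B)) (cycle_free (split_space V X q))" if X: "X \<subseteq> ground B" for X
  proof -
    let ?S = "element_splitting m A B X q"
    have fin': "finite (insert q (ground B))" using fin by simp
    have S: "matroid ?S" "ground ?S = insert q (ground B)"
      unfolding element_splitting_def using matroid_vector_matroid[OF fin'] by simp_all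
    have I: "I \<in> indeps ?S \<longleftrightarrow> cycle_free (split_space V X q) I" if "I \<subseteq> insert q (ground B)" for I
      unfolding element_splitting_def indeps_vector_matroid[OF fin']
        cycle_space_splitting[OF fin assms(3) X] V_def using that by simp
    have "represents (Suc m) (splitting_matrix m A X q) ?S"
      unfolding represents_def S(2) by (simp add: element_splitting_def)
    then have "binary_matroid ?S" unfolding binary_matroid_def using S(1) by blast
    then have "binary_gammoid ?S \<longleftrightarrow> gammoid_indep (insert q (ground B)) (\<lambda>I. I \<in> indeps ?S)"
      unfolding binary_gammoid_def gammoid_iff_gammoid_indep S(2) using S(1) by blast
    also have "\<dots> \<longleftrightarrow> gammoid_indep (insert q (ground B)) (cycle_free (split_space V X q))"
      using gammoid_indep_cong I by (metis (no_types, lifting))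
    finally show ?thesis .
  qed
  show ?thesis unfolding G7
  proof
    assume L: "\<forall>X. X \<subseteq> ground B \<and> 2 \<le> card X \<longrightarrow> binary_gammoid (element_splitting m A B X q)"
    show "\<not> G7_config (ground B) V"
    proof
      assume "G7_config (ground B) V"
      then obtain X where X: "X \<subseteq> ground B" "card X = 2"
        "\<not> gammoid_indep (insert q (ground B)) (cycle_free (split_space V X q))"
        using G7_config_not_gammoid[OF V assms(3)] by blast
      then show False using L bg[OF X(1)] by simp
    qed
  next
    assume "\<not> G7_config (ground B) V"
    then show "\<forall>X. X \<subseteq> ground B \<and> 2 \<le> card X \<longrightarrow> binary_gammoid (element_splitting m A B X q)"
      using bg gammoid_indep_split_space[OF V assms(3)] by blast
  qed
qed

end
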